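(* The ideally exact context $K\dashv U$, where $U\colon\mathsf{PAlg}\to\mathsf{PHoops}$ is the forgetful functor from product algebras to product hoops and $K$ is its left adjoint, is BAT.
   Context: A hoop is an algebra $(H,\cdot,\to,1)$ such that $(H,\cdot,1)$ is a commutative monoid and, for all $x,y,z$: $x\to x=1$; $x\cdot(x\to y)=y\cdot(y\to x)$; $(x\cdot y)\to z=x\to(y\to z)$. A basic hoop is a hoop with $((x\to y)\to z)\to(((y\to x)\to z)\to z)=1$. A product hoop is a basic hoop with $(y\to z)\vee((y\to(x\cdot y))\to x)=1$, where $x\wedge y=x\cdot(x\to y)$ and $x\vee y=((x\to y)\to y)\wedge((y\to x)\to x)$. A BL-algebra is a bounded (commutative, integral) residuated lattice $(A,\vee,\wedge,\cdot,\to,0,1)$ with $x\wedge y=x\cdot(x\to y)$ and $(x\to y)\vee(y\to x)=1$; a product algebra is a BL-algebra with $\neg x\vee((x\to x\cdot y)\to y)=1$, where $\neg x=x\to0$. Morphisms preserve all operations. $U$ sends a product algebra $A$ to $(A,\cdot,\to,1)$ (product algebras are term equivalent to product hoops with a constant $0$ satisfying $0\to x=1$). The adjunction $K\dashv U$ is an ideally exact context: a monadic adjunction $F\dashv U$, $U\colon\mathsf{U}\to\mathsf{V}$, with $\mathsf{U}$ ideally exact (Barr-exact, protomodular, finite coproducts, initial-to-terminal morphism a regular epimorphism), $\mathsf{V}$ semi-abelian and cartesian unit $\eta$; here $\mathsf{U}=\mathsf{PAlg}$, $\mathsf{V}=\mathsf{PHoops}$, $F=K$. The zero object of $\mathsf{V}$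 is the trivial hoop, written $0$ below; $F(0)=L_2=\{0,1\}$ is initial in $\mathsf{U}$. Write $\iota_B\colon F(0)\to B$ for the unique morphism in $\mathsf{U}$, and $\tau_X\colon X\to0$, $\iota_X\colon0\to X$ in $\mathsf{V}$. Internal actions in $\mathsf{V}$: $\kappa_{C,X}\colon C\flat X\to C+X$ denotes a kernel of $[\mathrm{id}_C,0]\colon C+X\to C$ ($+$ is coproduct in $\mathsf{V}$ and $0$ the zero morphism). $C\flat(-)$ is a monad on $\mathsf{V}$ (unit $u_X$ with $\kappa_{C,X}u_X=i_2$, multiplication $\mu_X$ with $\kappa_{C,X}\mu_X=[i_1,\kappa_{C,X}]\kappa_{C,C\flat X}$); an internal action of $C$ on $X$ is an algebra $\xi\colon C\flat X\to X$. For $g\colon C\to D$, $g\flat\mathrm{id}_X$ is the unique morphism with $\kappa_{D,X}(g\flat\mathrm{id}_X)=(g+\mathrm{id}_X)\kappa_{C,X}$. A point over $C$ (split epimorphism $p\colon A\to C$ with chosen section $s$) is associated with $\xi$ if there is a kernel $k\colon X\to A$ of $p$ with $k\xi=[s,k]\kappa_{C,X}$; this gives an equivalence between points over $C$ and internal actions of $C$. A relative $U$-action of $B\in\mathsf{U}$ on $X\in\mathsf{V}$ is an internal action $\xi\colon U(B)\flat X\to X$. $\xi_0\colon UF(0)\flat X\to X$ is the action with $\eta_X\xi_0=[UF(\iota_X),\eta_X]\kappa_{UF(0),X}$ (associated with the point $(UF(\tau_X),UF(\iota_X))$ with kernel $\eta_X$). $\xi$ is coherent if $\xi\circ(U(\iota_B)\flat\mathrm{id}_X)=\xi_0$.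 A point $(p\colon A\to U(B),s)$ in $\mathsf{V}$ is ideal if there exist a point $(p'\colon A'\to B,s')$ in $\mathsf{U}$ and an isomorphism $\sigma\colon U(A')\to A$ with $p\sigma=U(p')$, $\sigma U(s')=s$; a relative $U$-action is ideal if any associated point is ideal. A morphism $h\colon A_1\to A_2$ of ideal points $(p_i\colon A_i\to U(B),s_i)$, $i=1,2$, over $U(B)$ (commuting with retractions and sections) is ideal if there is a morphism $h'\colon A_1'\to A_2'$ of points over $B$ in $\mathsf{U}$ between corresponding points $(p_i'\colon A_i'\to B,s_i')$ (with isomorphisms $\sigma_i\colon U(A_i')\to A_i$ satisfying $p_i\sigma_i=U(p_i')$ and $\sigma_iU(s_i')=s_i$) such that $h\sigma_1=\sigma_2U(h')$; a morphism of ideal actions of the same $B$ is ideal if the corresponding morphism of points is. The ideally exact context is BAT if all coherent actions are ideal and all morphisms of such actions are ideal. *)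

theory Defs
  imports "HOL-Algebra.Group"
begin

section \<open>Product hoops\<close>

record 'a hoop = "'a monoid" +
  imp :: "'a \<Rightarrow> 'a \<Rightarrow> 'a"  (infixr \<open>\<leadsto>\<index>\<close> 65)

locale hoop = comm_monoid H for H :: "('a, 'm) hoop_scheme" (structure) +
  assumes imp_closed [intro, simp]:
      "\<lbrakk>x \<in> carrier H; y \<in> carrier H\<rbrakk> \<Longrightarrow> x \<leadsto> y \<in> carrier H"
    and imp_self: "x \<in> carrier H \<Longrightarrow> x \<leadsto> x = \<one>"
    and divisibility:
      "\<lbrakk>x \<in> carrier H; y \<in> carrier H\<rbrakk> \<Longrightarrow> x \<otimes> (x \<leadsto> y) = y \<otimes> (y \<leadsto> x)"
    and currying:
      "\<lbrakk>x \<in> carrier H; y \<in> carrier H; z \<in> carrier H\<rbrakk>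
        \<Longrightarrow> (x \<otimes> y) \<leadsto> z = x \<leadsto> (y \<leadsto> z)"

locale basic_hoop = hoop +
  assumes basic:
      "\<lbrakk>x \<in> carrier H; y \<in> carrier H; z \<in> carrier H\<rbrakk>
        \<Longrightarrow> ((x \<leadsto> y) \<leadsto> z) \<leadsto> (((y \<leadsto> x) \<leadsto> z) \<leadsto> z) = \<one>"

definition hoop_meet :: "('a, 'm) hoop_scheme \<Rightarrow> 'a \<Rightarrow> 'a \<Rightarrow> 'a" where
  "hoop_meet H x y = x \<otimes>\<^bsub>H\<^esub> (x \<leadsto>\<^bsub>H\<^esub> y)"

definition hoop_join :: "('a, 'm) hoop_scheme \<Rightarrow> 'a \<Rightarrow> 'a \<Rightarrow> 'a" where
  "hoop_join H x y =
     hoop_meet H ((x \<leadsto>\<^bsub>H\<^esub> y) \<leadsto>\<^bsub>H\<^esub> y) ((y \<leadsto>\<^bsub>H\<^esub> x) \<leadsto>\<^bsub>H\<^esub> x)"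

locale product_hoop = basic_hoop +
  assumes product_axiom:
      "\<lbrakk>x \<in> carrier H; y \<in> carrier H; z \<in> carrier H\<rbrakk>
        \<Longrightarrow> hoop_join H (y \<leadsto> z) ((y \<leadsto> (x \<otimes> y)) \<leadsto> x) = \<one>"

definition hoop_hom :: "('a, 'm) hoop_scheme \<Rightarrow> ('b, 'n) hoop_scheme \<Rightarrow> ('a \<Rightarrow> 'b) set" where
  "hoop_hom G H = {f \<in> carrier G \<rightarrow> carrier H.
     f \<one>\<^bsub>G\<^esub> = \<one>\<^bsub>H\<^esub> \<and>
     (\<forall>x\<in>carrier G. \<forall>y\<in>carrier G. f (x \<otimes>\<^bsub>G\<^esub> y) = f x \<otimes>\<^bsub>H\<^esub> f y) \<and>
     (\<forall>x\<in>carrier G. \<forall>y\<in>carrier G. f (x \<leadsto>\<^bsub>G\<^esub> y) = f x \<leadsto>\<^bsub>H\<^esub> f y)}"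

definition trivial_hoop :: "unit hoop" where
  "trivial_hoop = \<lparr>carrier = UNIV, mult = (\<lambda>_ _. ()), one = (), imp = (\<lambda>_ _. ())\<rparr>"

lemma product_hoop_trivial: "product_hoop trivial_hoop"
  by unfold_locales (auto simp: trivial_hoop_def Units_def)


section \<open>Product algebras\<close>

record 'a palg = "'a hoop" +
  vee :: "'a \<Rightarrow> 'a \<Rightarrow> 'a"  (infixl \<open>\<curlyvee>\<index>\<close> 60)
  wedge :: "'a \<Rightarrow> 'a \<Rightarrow> 'a"  (infixl \<open>\<curlywedge>\<index>\<close> 62)
  zero :: 'a  (\<open>\<zero>\<index>\<close>)

text \<open>The lattice order is \<open>x \<le> y \<longleftrightarrow> x \<curlywedge> y = x\<close>.\<close>

locale bounded_residuated_lattice =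
  comm_monoid A for A :: "('a, 'm) palg_scheme" (structure) +
  assumes imp_closed [intro, simp]:
      "\<lbrakk>x \<in> carrier A; y \<in> carrier A\<rbrakk> \<Longrightarrow> x \<leadsto> y \<in> carrier A"
    and join_closed [intro, simp]:
      "\<lbrakk>x \<in> carrier A; y \<in> carrier A\<rbrakk> \<Longrightarrow> x \<curlyvee> y \<in> carrier A"
    and meet_closed [intro, simp]:
      "\<lbrakk>x \<in> carrier A; y \<in> carrier A\<rbrakk> \<Longrightarrow> x \<curlywedge> y \<in> carrier A"
    and zero_closed [intro, simp]: "\<zero> \<in> carrier A"
    and join_assoc:
      "\<lbrakk>x \<in> carrier A; y \<in> carrier A; z \<in> carrier A\<rbrakk>
        \<Longrightarrow> (x \<curlyvee> y) \<curlyvee> z = x \<curlyvee> (y \<curlyvee> z)"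
    and meet_assoc:
      "\<lbrakk>x \<in> carrier A; y \<in> carrier A; z \<in> carrier A\<rbrakk>
        \<Longrightarrow> (x \<curlywedge> y) \<curlywedge> z = x \<curlywedge> (y \<curlywedge> z)"
    and join_comm: "\<lbrakk>x \<in> carrier A; y \<in> carrier A\<rbrakk> \<Longrightarrow> x \<curlyvee> y = y \<curlyvee> x"
    and meet_comm: "\<lbrakk>x \<in> carrier A; y \<in> carrier A\<rbrakk> \<Longrightarrow> x \<curlywedge> y = y \<curlywedge> x"
    and join_absorb: "\<lbrakk>x \<in> carrier A; y \<in> carrier A\<rbrakk> \<Longrightarrow> x \<curlyvee> (x \<curlywedge> y) = x"
    and meet_absorb: "\<lbrakk>x \<in> carrier A; y \<in> carrier A\<rbrakk> \<Longrightarrow> x \<curlywedge> (x \<curlyvee> y) = x"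
    and zero_least: "x \<in> carrier A \<Longrightarrow> \<zero> \<curlywedge> x = \<zero>"
    and one_greatest: "x \<in> carrier A \<Longrightarrow> x \<curlywedge> \<one> = x"
    and residuation:
      "\<lbrakk>x \<in> carrier A; y \<in> carrier A; z \<in> carrier A\<rbrakk>
        \<Longrightarrow> (x \<otimes> y) \<curlywedge> z = x \<otimes> y \<longleftrightarrow> x \<curlywedge> (y \<leadsto> z) = x"

locale BL_algebra = bounded_residuated_lattice +
  assumes divisibility: "\<lbrakk>x \<in> carrier A; y \<in> carrier A\<rbrakk> \<Longrightarrow> x \<curlywedge> y = x \<otimes> (x \<leadsto> y)"
    and prelinearity:
      "\<lbrakk>x \<in> carrier A; y \<in> carrier A\<rbrakk> \<Longrightarrow> (x \<leadsto> y) \<curlyvee> (y \<leadsto> x) = \<one>"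

locale product_algebra = BL_algebra +
  assumes product_axiom:
      "\<lbrakk>x \<in> carrier A; y \<in> carrier A\<rbrakk>
        \<Longrightarrow> (x \<leadsto> \<zero>) \<curlyvee> ((x \<leadsto> (x \<otimes> y)) \<leadsto> y) = \<one>"

definition palg_hom :: "('a, 'm) palg_scheme \<Rightarrow> ('b, 'n) palg_scheme \<Rightarrow> ('a \<Rightarrow> 'b) set" where
  "palg_hom A B = {f \<in> hoop_hom A B.
     f \<zero>\<^bsub>A\<^esub> = \<zero>\<^bsub>B\<^esub> \<and>
     (\<forall>x\<in>carrier A. \<forall>y\<in>carrier A. f (x \<curlyvee>\<^bsub>A\<^esub> y) = f x \<curlyvee>\<^bsub>B\<^esub> f y) \<and>
     (\<forall>x\<in>carrier A. \<forall>y\<in>carrier A. f (x \<curlywedge>\<^bsub>A\<^esub> y) = f x \<curlywedge>\<^bsub>B\<^esub> f y)}"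

text \<open>The forgetful functor; on morphisms it is the identity.\<close>

definition U :: "'a palg \<Rightarrow> 'a hoop" where
  "U A = \<lparr>carrier = carrier A, mult = mult A, one = one A, imp = imp A\<rparr>"

lemma U_simps [simp]:
  "carrier (U A) = carrier A" "mult (U A) = mult A" "one (U A) = one A" "imp (U A) = imp A"
  by (simp_all add: U_def)

lemma palg_hom_imp_hoop_hom: "f \<in> palg_hom A B \<Longrightarrow> f \<in> hoop_hom (U A) (U B)"
  by (simp add: palg_hom_def hoop_hom_def)

lemma product_hoop_U:
  assumes "product_algebra A"
  shows "product_hoop (U A)"
proof -
  interpret product_algebra A by fact
  define le where "le x y \<longleftrightarrow> x \<curlywedge>\<^bsub>A\<^esub> y = x" for x y
  have le_refl: "le x x" if "x \<in> carrier A" for x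
    using that unfolding le_def by (metis join_absorb meet_absorb meet_closed)
  have le_trans: "le x z" if "le x y" "le y z" "x \<in> carrier A" "y \<in> carrier A" "z \<in> carrier A"
    for x y z using that unfolding le_def by (metis meet_assoc)
  have antisym: "x = y" if "le x y" "le y x" "x \<in> carrier A" "y \<in> carrier A" for x y
    using that unfolding le_def by (metis meet_comm)
  have res: "le (x \<otimes>\<^bsub>A\<^esub> y) z \<longleftrightarrow> le x (y \<leadsto>\<^bsub>A\<^esub> z)"
    if "x \<in> carrier A" "y \<in> carrier A" "z \<in> carrier A" for x y z
    using residuation that unfolding le_def by blast
  have top: "le x \<one>\<^bsub>A\<^esub>" if "x \<in> carrier A" for x
    using one_greatest that by (simp add: le_def)
  have top_eq: "x = \<one>\<^bsub>A\<^esub>" if "le \<one>\<^bsub>A\<^esub> x" "x \<in> carrier A" for x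
    using antisym that top by auto
  have imp1: "x \<leadsto>\<^bsub>A\<^esub> y = \<one>\<^bsub>A\<^esub> \<longleftrightarrow> le x y"
    if "x \<in> carrier A" "y \<in> carrier A" for x y
    using that res[of "\<one>\<^bsub>A\<^esub>" x y] by (metis imp_closed l_one le_refl one_closed top_eq)
  have cur: "(x \<otimes>\<^bsub>A\<^esub> y) \<leadsto>\<^bsub>A\<^esub> z = x \<leadsto>\<^bsub>A\<^esub> (y \<leadsto>\<^bsub>A\<^esub> z)"
    if c: "x \<in> carrier A" "y \<in> carrier A" "z \<in> carrier A" for x y z
  proof -
    have *: "le w ((x \<otimes>\<^bsub>A\<^esub> y) \<leadsto>\<^bsub>A\<^esub> z) \<longleftrightarrow> le w (x \<leadsto>\<^bsub>A\<^esub> (y \<leadsto>\<^bsub>A\<^esub> z))"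
      if "w \<in> carrier A" for w
      using c that by (metis imp_closed m_assoc m_closed res)
    show ?thesis
      using *[of "(x \<otimes>\<^bsub>A\<^esub> y) \<leadsto>\<^bsub>A\<^esub> z"] *[of "x \<leadsto>\<^bsub>A\<^esub> (y \<leadsto>\<^bsub>A\<^esub> z)"] c
      by (auto intro!: antisym le_refl)
  qed
  have ub1: "le x (x \<curlyvee>\<^bsub>A\<^esub> y)" and ub2: "le y (x \<curlyvee>\<^bsub>A\<^esub> y)"
    if "x \<in> carrier A" "y \<in> carrier A" for x y
    using that unfolding le_def by (metis join_comm meet_absorb)+
  have lub: "le (x \<curlyvee>\<^bsub>A\<^esub> y) z" if "le x z" "le y z"
    "x \<in> carrier A" "y \<in> carrier A" "z \<in> carrier A" for x y z
    using that unfolding le_def by (metis join_absorb join_assoc join_comm join_closed meet_absorb meet_comm)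
  have glb: "le z (x \<curlywedge>\<^bsub>A\<^esub> y)" if "le z x" "le z y"
    "x \<in> carrier A" "y \<in> carrier A" "z \<in> carrier A" for x y z
    using that unfolding le_def by (metis meet_assoc)
  have lb1: "le (x \<curlywedge>\<^bsub>A\<^esub> y) x" and lb2: "le (x \<curlywedge>\<^bsub>A\<^esub> y) y"
    if "x \<in> carrier A" "y \<in> carrier A" for x y
    using that unfolding le_def
    by (metis join_absorb meet_absorb meet_assoc meet_closed meet_comm)+
  have mp: "le (x \<otimes>\<^bsub>A\<^esub> (x \<leadsto>\<^bsub>A\<^esub> y)) y" if "x \<in> carrier A" "y \<in> carrier A" for x y
    using that lb2 divisibility by metis
  have swap: "le x ((x \<leadsto>\<^bsub>A\<^esub> y) \<leadsto>\<^bsub>A\<^esub> y)" if "x \<in> carrier A" "y \<in> carrier A" for x y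
    using that mp res by (metis imp_closed)
  have anti: "le (y \<leadsto>\<^bsub>A\<^esub> z) (x \<leadsto>\<^bsub>A\<^esub> z)" if "le x y"
    "x \<in> carrier A" "y \<in> carrier A" "z \<in> carrier A" for x y z
  proof -
    have "le x ((y \<leadsto>\<^bsub>A\<^esub> z) \<leadsto>\<^bsub>A\<^esub> z)"
      using that swap[of y z] le_trans by (meson imp_closed)
    then show ?thesis using that by (metis imp_closed m_comm res)
  qed
  have one_imp: "\<one>\<^bsub>A\<^esub> \<leadsto>\<^bsub>A\<^esub> x = x" if "x \<in> carrier A" for x
  proof (rule antisym)
    show "le (\<one>\<^bsub>A\<^esub> \<leadsto>\<^bsub>A\<^esub> x) x"
      using that mp[of "\<one>\<^bsub>A\<^esub>" x] by simp
    show "le x (\<one>\<^bsub>A\<^esub> \<leadsto>\<^bsub>A\<^esub> x)" using that by (metis le_refl one_closed r_one res)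
  qed (use that in auto)
  have bas: "le ((x \<leadsto>\<^bsub>A\<^esub> y) \<leadsto>\<^bsub>A\<^esub> z) (((y \<leadsto>\<^bsub>A\<^esub> x) \<leadsto>\<^bsub>A\<^esub> z) \<leadsto>\<^bsub>A\<^esub> z)"
    if c: "x \<in> carrier A" "y \<in> carrier A" "z \<in> carrier A" for x y z
  proof -
    define p q where "p = (x \<leadsto>\<^bsub>A\<^esub> y) \<leadsto>\<^bsub>A\<^esub> z" and "q = (y \<leadsto>\<^bsub>A\<^esub> x) \<leadsto>\<^bsub>A\<^esub> z"
    have pq: "p \<in> carrier A" "q \<in> carrier A" using c by (auto simp: p_def q_def)
    define w where "w = (p \<otimes>\<^bsub>A\<^esub> q) \<leadsto>\<^bsub>A\<^esub> z"
    have w: "w \<in> carrier A" using pq c by (simp add: w_def)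
    have mle: "le (a \<otimes>\<^bsub>A\<^esub> b) a" "le (b \<otimes>\<^bsub>A\<^esub> a) a" if "a \<in> carrier A" "b \<in> carrier A" for a b
    proof -
      have "le b (a \<leadsto>\<^bsub>A\<^esub> a)" using that by (metis imp1 le_refl top)
      then show "le (b \<otimes>\<^bsub>A\<^esub> a) a" using that res by blast
      then show "le (a \<otimes>\<^bsub>A\<^esub> b) a" using that by (simp add: m_comm)
    qed
    have "le (x \<leadsto>\<^bsub>A\<^esub> y) w"
    proof -
      have "le (x \<leadsto>\<^bsub>A\<^esub> y) (p \<leadsto>\<^bsub>A\<^esub> z)" unfolding p_def using swap c by simp
      moreover have "le (p \<leadsto>\<^bsub>A\<^esub> z) w" unfolding w_def using anti mle pq c by simp
      ultimately show ?thesis using le_trans c pq w by (meson imp_closed)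
    qed
    moreover have "le (y \<leadsto>\<^bsub>A\<^esub> x) w"
    proof -
      have "le (y \<leadsto>\<^bsub>A\<^esub> x) (q \<leadsto>\<^bsub>A\<^esub> z)" unfolding q_def using swap c by simp
      moreover have "le (q \<leadsto>\<^bsub>A\<^esub> z) w" unfolding w_def using anti mle pq c by simp
      ultimately show ?thesis using le_trans c pq w by (meson imp_closed)
    qed
    ultimately have "le \<one>\<^bsub>A\<^esub> w"
      using lub[of "x \<leadsto>\<^bsub>A\<^esub> y" w "y \<leadsto>\<^bsub>A\<^esub> x"] prelinearity c w by simp
    then have "w = \<one>\<^bsub>A\<^esub>" using top_eq w by simp
    then have "p \<leadsto>\<^bsub>A\<^esub> (q \<leadsto>\<^bsub>A\<^esub> z) = \<one>\<^bsub>A\<^esub>" using cur pq c by (simp add: w_def)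
    then show ?thesis using imp1 pq c unfolding p_def q_def by simp
  qed
  have hm: "hoop_meet (U A) x y = x \<curlywedge>\<^bsub>A\<^esub> y" if "x \<in> carrier A" "y \<in> carrier A" for x y
    using that divisibility by (simp add: hoop_meet_def)
  have hj_ge: "le (x \<curlyvee>\<^bsub>A\<^esub> y) (hoop_join (U A) x y)" if "x \<in> carrier A" "y \<in> carrier A" for x y
  proof -
    have "le x ((y \<leadsto>\<^bsub>A\<^esub> x) \<leadsto>\<^bsub>A\<^esub> x)" "le y ((x \<leadsto>\<^bsub>A\<^esub> y) \<leadsto>\<^bsub>A\<^esub> y)"
      using that by (metis imp_closed imp1 le_refl res m_comm top le_trans one_closed mp anti one_imp)+
    then show ?thesis
      using that swap[of x y] swap[of y x] by (simp add: hoop_join_def hm lub glb)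
  qed
  show ?thesis
  proof (unfold_locales, simp_all add: m_assoc)
    fix x y z assume c: "x \<in> carrier A" "y \<in> carrier A"
    show "x \<otimes>\<^bsub>A\<^esub> y = y \<otimes>\<^bsub>A\<^esub> x" using c m_comm by simp
    show "x \<leadsto>\<^bsub>A\<^esub> x = \<one>\<^bsub>A\<^esub>" using c imp1 le_refl by simp
    show "x \<otimes>\<^bsub>A\<^esub> (x \<leadsto>\<^bsub>A\<^esub> y) = y \<otimes>\<^bsub>A\<^esub> (y \<leadsto>\<^bsub>A\<^esub> x)"
      using c divisibility meet_comm by metis
    assume z: "z \<in> carrier A"
    show "x \<otimes>\<^bsub>A\<^esub> y \<leadsto>\<^bsub>A\<^esub> z = x \<leadsto>\<^bsub>A\<^esub> (y \<leadsto>\<^bsub>A\<^esub> z)" using cur c z by simp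
    show "((x \<leadsto>\<^bsub>A\<^esub> y) \<leadsto>\<^bsub>A\<^esub> z) \<leadsto>\<^bsub>A\<^esub> (((y \<leadsto>\<^bsub>A\<^esub> x) \<leadsto>\<^bsub>A\<^esub> z) \<leadsto>\<^bsub>A\<^esub> z) = \<one>\<^bsub>A\<^esub>"
      using bas imp1 c z by simp
    let ?r = "(y \<leadsto>\<^bsub>A\<^esub> (x \<otimes>\<^bsub>A\<^esub> y)) \<leadsto>\<^bsub>A\<^esub> x"
    let ?n = "y \<leadsto>\<^bsub>A\<^esub> \<zero>\<^bsub>A\<^esub>" and ?i = "y \<leadsto>\<^bsub>A\<^esub> z"
    have cl: "?r \<in> carrier A" "?n \<in> carrier A" "?i \<in> carrier A" using c z by auto
    have "le (?n \<otimes>\<^bsub>A\<^esub> y) \<zero>\<^bsub>A\<^esub>" using c res[of ?n y "\<zero>\<^bsub>A\<^esub>"] le_refl[of ?n] by simp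
    moreover have "le \<zero>\<^bsub>A\<^esub> z" using zero_least z by (simp add: le_def)
    ultimately have "le (?n \<otimes>\<^bsub>A\<^esub> y) z"
      using c z by (blast intro: le_trans[of _ "\<zero>\<^bsub>A\<^esub>"])
    then have "le ?n ?i" using c z res[of ?n y z] by simp
    then have "le ?n (?i \<curlyvee>\<^bsub>A\<^esub> ?r)"
      using cl ub1[of ?i ?r] le_trans[of ?n ?i] by simp
    then have "le (?n \<curlyvee>\<^bsub>A\<^esub> ?r) (?i \<curlyvee>\<^bsub>A\<^esub> ?r)"
      using cl ub2[of ?i ?r] lub[of ?n "?i \<curlyvee>\<^bsub>A\<^esub> ?r" ?r] by simp
    then have "le \<one>\<^bsub>A\<^esub> (?i \<curlyvee>\<^bsub>A\<^esub> ?r)"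
      using product_axiom[of y x] c by (simp add: m_comm)
    moreover have j: "hoop_join (U A) ?i ?r \<in> carrier A"
      using c z by (simp add: hoop_join_def hoop_meet_def)
    ultimately have "le \<one>\<^bsub>A\<^esub> (hoop_join (U A) ?i ?r)"
      using hj_ge[of ?i ?r] cl le_trans[of "\<one>\<^bsub>A\<^esub>" "?i \<curlyvee>\<^bsub>A\<^esub> ?r"] by simp
    then show "hoop_join (U A) ?i ?r = \<one>\<^bsub>A\<^esub>" using top_eq j by blast
  qed
qed


section \<open>Coproducts of product hoops\<close>

text \<open>Quotients of term algebras by a partial equivalence \<open>R\<close>; the terms concerned are those
  with \<open>R t t\<close>.\<close>

definition eq_class :: "('t \<Rightarrow> 't \<Rightarrow> bool) \<Rightarrow> 't \<Rightarrow> 't set" where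
  "eq_class R t = {u. R t u}"

definition quot_op :: "('t \<Rightarrow> 't \<Rightarrow> bool) \<Rightarrow> ('t \<Rightarrow> 't \<Rightarrow> 't) \<Rightarrow> 't set \<Rightarrow> 't set \<Rightarrow> 't set" where
  "quot_op R f S T = {w. \<exists>t\<in>S. \<exists>u\<in>T. R (f t u) w}"

lemma eq_class_eq_iff:
  assumes "symp R" "transp R" "R t t"
  shows "eq_class R t = eq_class R u \<longleftrightarrow> R t u"
  using assms unfolding eq_class_def symp_def transp_def by blast

lemma quot_op_eq_class:
  assumes "symp R" "transp R" "R t t" "R u u"
    and "\<And>t t' u u'. R t t' \<Longrightarrow> R u u' \<Longrightarrow> R (f t u) (f t' u')"
  shows "quot_op R f (eq_class R t) (eq_class R u) = eq_class R (f t u)"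
proof (rule equalityI; rule subsetI)
  fix w
  show "w \<in> quot_op R f (eq_class R t) (eq_class R u) \<Longrightarrow> w \<in> eq_class R (f t u)"
    using assms(5) transpD[OF assms(2)] unfolding eq_class_def quot_op_def by blast
  show "w \<in> eq_class R (f t u) \<Longrightarrow> w \<in> quot_op R f (eq_class R t) (eq_class R u)"
    using assms(3,4) unfolding eq_class_def quot_op_def by blast
qed

lemma some_in_eq_class: "R t t \<Longrightarrow> R t (SOME u. u \<in> eq_class R t)"
  unfolding eq_class_def by (metis mem_Collect_eq someI)

datatype (set_hterm: 'g) hterm =
    HGen 'g
  | HOne
  | HMul "'g hterm" "'g hterm"  (infixl \<open>\<odot>\<close> 70)
  | HImp "'g hterm" "'g hterm"  (infixr \<open>\<rightharpoonup>\<close> 65)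

abbreviation hterm_meet :: "'g hterm \<Rightarrow> 'g hterm \<Rightarrow> 'g hterm" where
  "hterm_meet x y \<equiv> x \<odot> (x \<rightharpoonup> y)"

abbreviation hterm_join :: "'g hterm \<Rightarrow> 'g hterm \<Rightarrow> 'g hterm" where
  "hterm_join x y \<equiv> hterm_meet ((x \<rightharpoonup> y) \<rightharpoonup> y) ((y \<rightharpoonup> x) \<rightharpoonup> x)"

inductive hoop_law :: "'g hterm \<Rightarrow> 'g hterm \<Rightarrow> bool" where
  "hoop_law ((x \<odot> y) \<odot> z) (x \<odot> (y \<odot> z))"
| "hoop_law (x \<odot> y) (y \<odot> x)"
| "hoop_law (HOne \<odot> x) x"
| "hoop_law (x \<rightharpoonup> x) HOne"
| "hoop_law (x \<odot> (x \<rightharpoonup> y)) (y \<odot> (y \<rightharpoonup> x))"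
| "hoop_law ((x \<odot> y) \<rightharpoonup> z) (x \<rightharpoonup> (y \<rightharpoonup> z))"
| "hoop_law (((x \<rightharpoonup> y) \<rightharpoonup> z) \<rightharpoonup> (((y \<rightharpoonup> x) \<rightharpoonup> z) \<rightharpoonup> z)) HOne"
| "hoop_law (hterm_join (y \<rightharpoonup> z) ((y \<rightharpoonup> (x \<odot> y)) \<rightharpoonup> x)) HOne"

definition coprod_terms :: "'c hoop \<Rightarrow> 'x hoop \<Rightarrow> ('c + 'x) hterm set" where
  "coprod_terms C X = {t. set_hterm t \<subseteq> carrier C <+> carrier X}"

inductive coprod_eq :: "'c hoop \<Rightarrow> 'x hoop \<Rightarrow> ('c + 'x) hterm \<Rightarrow> ('c + 'x) hterm \<Rightarrow> bool"
  for C X where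
  refl: "t \<in> coprod_terms C X \<Longrightarrow> coprod_eq C X t t"
| sym: "coprod_eq C X t u \<Longrightarrow> coprod_eq C X u t"
| trans: "coprod_eq C X t u \<Longrightarrow> coprod_eq C X u v \<Longrightarrow> coprod_eq C X t v"
| mul: "coprod_eq C X t t' \<Longrightarrow> coprod_eq C X u u' \<Longrightarrow> coprod_eq C X (t \<odot> u) (t' \<odot> u')"
| imp: "coprod_eq C X t t' \<Longrightarrow> coprod_eq C X u u' \<Longrightarrow> coprod_eq C X (t \<rightharpoonup> u) (t' \<rightharpoonup> u')"
| law: "hoop_law t u \<Longrightarrow> t \<in> coprod_terms C X \<Longrightarrow> u \<in> coprod_terms C X \<Longrightarrow> coprod_eq C X t u"
| one_l: "coprod_eq C X (HGen (Inl \<one>\<^bsub>C\<^esub>)) HOne"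
| mul_l: "c \<in> carrier C \<Longrightarrow> d \<in> carrier C
    \<Longrightarrow> coprod_eq C X (HGen (Inl c) \<odot> HGen (Inl d)) (HGen (Inl (c \<otimes>\<^bsub>C\<^esub> d)))"
| imp_l: "c \<in> carrier C \<Longrightarrow> d \<in> carrier C
    \<Longrightarrow> coprod_eq C X (HGen (Inl c) \<rightharpoonup> HGen (Inl d)) (HGen (Inl (c \<leadsto>\<^bsub>C\<^esub> d)))"
| one_r: "coprod_eq C X (HGen (Inr \<one>\<^bsub>X\<^esub>)) HOne"
| mul_r: "x \<in> carrier X \<Longrightarrow> y \<in> carrier X
    \<Longrightarrow> coprod_eq C X (HGen (Inr x) \<odot> HGen (Inr y)) (HGen (Inr (x \<otimes>\<^bsub>X\<^esub> y)))"
| imp_r: "x \<in> carrier X \<Longrightarrow> y \<in> carrier X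
    \<Longrightarrow> coprod_eq C X (HGen (Inr x) \<rightharpoonup> HGen (Inr y)) (HGen (Inr (x \<leadsto>\<^bsub>X\<^esub> y)))"

definition coprod :: "'c hoop \<Rightarrow> 'x hoop \<Rightarrow> ('c + 'x) hterm set hoop" where
  "coprod C X = \<lparr>carrier = eq_class (coprod_eq C X) ` coprod_terms C X,
     mult = quot_op (coprod_eq C X) (\<odot>),
     one = eq_class (coprod_eq C X) HOne,
     imp = quot_op (coprod_eq C X) (\<rightharpoonup>)\<rparr>"

definition in_l :: "'c hoop \<Rightarrow> 'x hoop \<Rightarrow> 'c \<Rightarrow> ('c + 'x) hterm set" where
  "in_l C X c = eq_class (coprod_eq C X) (HGen (Inl c))"

definition in_r :: "'c hoop \<Rightarrow> 'x hoop \<Rightarrow> 'x \<Rightarrow> ('c + 'x) hterm set" where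
  "in_r C X x = eq_class (coprod_eq C X) (HGen (Inr x))"

primrec hoop_eval :: "'d hoop \<Rightarrow> ('g \<Rightarrow> 'd) \<Rightarrow> 'g hterm \<Rightarrow> 'd" where
  "hoop_eval D v (HGen g) = v g"
| "hoop_eval D v HOne = \<one>\<^bsub>D\<^esub>"
| "hoop_eval D v (t \<odot> u) = hoop_eval D v t \<otimes>\<^bsub>D\<^esub> hoop_eval D v u"
| "hoop_eval D v (t \<rightharpoonup> u) = hoop_eval D v t \<leadsto>\<^bsub>D\<^esub> hoop_eval D v u"

text \<open>The morphism \<open>[f, g]\<close> out of a coproduct; by \<open>copair_eq_class\<close> below the choice of the representative
  is immaterial.\<close>

definition copair :: "'d hoop \<Rightarrow> ('c \<Rightarrow> 'd) \<Rightarrow> ('x \<Rightarrow> 'd) \<Rightarrow> ('c + 'x) hterm set \<Rightarrow> 'd" where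
  "copair D f g S = hoop_eval D (case_sum f g) (SOME t. t \<in> S)"

lemma coprod_terms_simps [simp]:
  "HOne \<in> coprod_terms C X"
  "HGen (Inl c) \<in> coprod_terms C X \<longleftrightarrow> c \<in> carrier C"
  "HGen (Inr x) \<in> coprod_terms C X \<longleftrightarrow> x \<in> carrier X"
  "t \<odot> u \<in> coprod_terms C X \<longleftrightarrow> t \<in> coprod_terms C X \<and> u \<in> coprod_terms C X"
  "t \<rightharpoonup> u \<in> coprod_terms C X \<longleftrightarrow> t \<in> coprod_terms C X \<and> u \<in> coprod_terms C X"
  by (auto simp: coprod_terms_def)

lemma coprod_eq_in_terms:
  assumes "coprod_eq C X t u" "product_hoop C" "product_hoop X"
  shows "t \<in> coprod_terms C X \<and> u \<in> coprod_terms C X"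
proof -
  interpret C: product_hoop C by fact
  interpret X: product_hoop X by fact
  from assms(1) show ?thesis by induction auto
qed

lemma per_coprod_eq: "symp (coprod_eq C X)" "transp (coprod_eq C X)"
  by (auto intro!: sympI transpI intro: coprod_eq.sym coprod_eq.trans)

lemma eq_class_coprod_eq:
  assumes "t \<in> coprod_terms C X"
  shows "eq_class (coprod_eq C X) t = eq_class (coprod_eq C X) u \<longleftrightarrow> coprod_eq C X t u"
  by (rule eq_class_eq_iff[OF per_coprod_eq coprod_eq.refl[OF assms]])

lemma coprod_ops:
  assumes "t \<in> coprod_terms C X" "u \<in> coprod_terms C X"
  shows "eq_class (coprod_eq C X) t \<otimes>\<^bsub>coprod C X\<^esub> eq_class (coprod_eq C X) u
      = eq_class (coprod_eq C X) (t \<odot> u)"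
    and "eq_class (coprod_eq C X) t \<leadsto>\<^bsub>coprod C X\<^esub> eq_class (coprod_eq C X) u
      = eq_class (coprod_eq C X) (t \<rightharpoonup> u)"
  using assms
  by (simp_all add: coprod_def quot_op_eq_class[OF per_coprod_eq] coprod_eq.intros)

lemma coprod_one: "\<one>\<^bsub>coprod C X\<^esub> = eq_class (coprod_eq C X) HOne"
  by (simp add: coprod_def)

lemma carrier_coprod: "carrier (coprod C X) = eq_class (coprod_eq C X) ` coprod_terms C X"
  by (simp add: coprod_def)

lemma product_hoopI:
  assumes "\<And>x y. x \<in> carrier H \<Longrightarrow> y \<in> carrier H \<Longrightarrow> x \<otimes>\<^bsub>H\<^esub> y \<in> carrier H"
    and "\<And>x y. x \<in> carrier H \<Longrightarrow> y \<in> carrier H \<Longrightarrow> x \<leadsto>\<^bsub>H\<^esub> y \<in> carrier H"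
    and "\<one>\<^bsub>H\<^esub> \<in> carrier H"
    and "\<And>x y z. x \<in> carrier H \<Longrightarrow> y \<in> carrier H \<Longrightarrow> z \<in> carrier H
      \<Longrightarrow> (x \<otimes>\<^bsub>H\<^esub> y) \<otimes>\<^bsub>H\<^esub> z = x \<otimes>\<^bsub>H\<^esub> (y \<otimes>\<^bsub>H\<^esub> z)"
    and "\<And>x y. x \<in> carrier H \<Longrightarrow> y \<in> carrier H \<Longrightarrow> x \<otimes>\<^bsub>H\<^esub> y = y \<otimes>\<^bsub>H\<^esub> x"
    and "\<And>x. x \<in> carrier H \<Longrightarrow> \<one>\<^bsub>H\<^esub> \<otimes>\<^bsub>H\<^esub> x = x"
    and "\<And>x. x \<in> carrier H \<Longrightarrow> x \<leadsto>\<^bsub>H\<^esub> x = \<one>\<^bsub>H\<^esub>"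
    and "\<And>x y. x \<in> carrier H \<Longrightarrow> y \<in> carrier H
      \<Longrightarrow> x \<otimes>\<^bsub>H\<^esub> (x \<leadsto>\<^bsub>H\<^esub> y) = y \<otimes>\<^bsub>H\<^esub> (y \<leadsto>\<^bsub>H\<^esub> x)"
    and "\<And>x y z. x \<in> carrier H \<Longrightarrow> y \<in> carrier H \<Longrightarrow> z \<in> carrier H
      \<Longrightarrow> (x \<otimes>\<^bsub>H\<^esub> y) \<leadsto>\<^bsub>H\<^esub> z = x \<leadsto>\<^bsub>H\<^esub> (y \<leadsto>\<^bsub>H\<^esub> z)"
    and "\<And>x y z. x \<in> carrier H \<Longrightarrow> y \<in> carrier H \<Longrightarrow> z \<in> carrier H
      \<Longrightarrow> ((x \<leadsto>\<^bsub>H\<^esub> y) \<leadsto>\<^bsub>H\<^esub> z) \<leadsto>\<^bsub>H\<^esub> (((y \<leadsto>\<^bsub>H\<^esub> x) \<leadsto>\<^bsub>H\<^esub> z) \<leadsto>\<^bsub>H\<^esub> z) = \<one>\<^bsub>H\<^esub>"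
    and "\<And>x y z. x \<in> carrier H \<Longrightarrow> y \<in> carrier H \<Longrightarrow> z \<in> carrier H
      \<Longrightarrow> hoop_join H (y \<leadsto>\<^bsub>H\<^esub> z) ((y \<leadsto>\<^bsub>H\<^esub> (x \<otimes>\<^bsub>H\<^esub> y)) \<leadsto>\<^bsub>H\<^esub> x) = \<one>\<^bsub>H\<^esub>"
  shows "product_hoop H"
proof -
  interpret comm_monoid H by (rule comm_monoidI) (use assms in auto)
  show ?thesis by unfold_locales (use assms in auto)
qed

lemma product_hoop_coprod: "product_hoop (coprod C X)"
  by (rule product_hoopI)
    (auto simp: carrier_coprod coprod_one coprod_ops hoop_join_def hoop_meet_def
      eq_class_coprod_eq intro!: coprod_eq.law hoop_law.intros imageI
      del: equalityI)

lemma hoop_eval_closed: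
  assumes "product_hoop D" "f \<in> hoop_hom C D" "g \<in> hoop_hom X D" "t \<in> coprod_terms C X"
  shows "hoop_eval D (case_sum f g) t \<in> carrier D"
proof -
  interpret product_hoop D by fact
  from assms(4) show ?thesis
  proof (induction t)
    case (HGen x)
    then show ?case using assms(2,3) by (cases x) (auto simp: hoop_hom_def)
  qed auto
qed

lemma coprod_eq_sound:
  assumes "product_hoop C" "product_hoop X"
    and D: "product_hoop D" "f \<in> hoop_hom C D" "g \<in> hoop_hom X D" and "coprod_eq C X t u"
  shows "hoop_eval D (case_sum f g) t = hoop_eval D (case_sum f g) u"
  using assms(6)
proof induction
  case (law t u)
  interpret D: product_hoop D by fact
  note cl = hoop_eval_closed[OF D]
  from law show ?case
    by cases
      (simp_all add: cl D.m_assoc D.imp_self D.currying D.basic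
        D.product_axiom[unfolded hoop_join_def hoop_meet_def],
       simp_all add: cl D.m_comm D.divisibility)
qed (use D in \<open>auto simp: hoop_hom_def\<close>)

lemma copair_eq_class:
  assumes "product_hoop C" "product_hoop X" "product_hoop D" "f \<in> hoop_hom C D" "g \<in> hoop_hom X D"
    and "t \<in> coprod_terms C X"
  shows "copair D f g (eq_class (coprod_eq C X) t) = hoop_eval D (case_sum f g) t"
  unfolding copair_def
  using coprod_eq_sound[OF assms(1-5) some_in_eq_class[of "coprod_eq C X"], OF coprod_eq.refl] assms(6)
  by simp

text \<open>The universal property of the coproduct.\<close>

lemma in_l_hom:
  assumes "product_hoop C"
  shows "in_l C X \<in> hoop_hom C (coprod C X)"
proof -
  interpret C: product_hoop C by fact
  show ?thesis
    by (auto simp: hoop_hom_def in_l_def carrier_coprod coprod_one coprod_ops eq_class_coprod_eq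
        intro: coprod_eq.one_l coprod_eq.sym[OF coprod_eq.mul_l] coprod_eq.sym[OF coprod_eq.imp_l]
        intro!: imageI del: equalityI)
qed

lemma in_r_hom:
  assumes "product_hoop X"
  shows "in_r C X \<in> hoop_hom X (coprod C X)"
proof -
  interpret X: product_hoop X by fact
  show ?thesis
    by (auto simp: hoop_hom_def in_r_def carrier_coprod coprod_one coprod_ops eq_class_coprod_eq
        intro: coprod_eq.one_r coprod_eq.sym[OF coprod_eq.mul_r] coprod_eq.sym[OF coprod_eq.imp_r]
        intro!: imageI del: equalityI)
qed

lemma copair:
  assumes "product_hoop C" "product_hoop X" "product_hoop D" "f \<in> hoop_hom C D" "g \<in> hoop_hom X D"
  shows copair_hom: "copair D f g \<in> hoop_hom (coprod C X) D"
    and copair_in_l: "c \<in> carrier C \<Longrightarrow> copair D f g (in_l C X c) = f c"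
    and copair_in_r: "x \<in> carrier X \<Longrightarrow> copair D f g (in_r C X x) = g x"
    and copair_unique: "h \<in> hoop_hom (coprod C X) D \<Longrightarrow> \<forall>c\<in>carrier C. h (in_l C X c) = f c
      \<Longrightarrow> \<forall>x\<in>carrier X. h (in_r C X x) = g x \<Longrightarrow> t \<in> carrier (coprod C X) \<Longrightarrow> h t = copair D f g t"
proof -
  note ev = copair_eq_class[OF assms]
  show "copair D f g \<in> hoop_hom (coprod C X) D"
    by (auto simp: hoop_hom_def carrier_coprod coprod_one coprod_ops ev
        hoop_eval_closed[OF assms(3-5)])
  show "c \<in> carrier C \<Longrightarrow> copair D f g (in_l C X c) = f c"
    and "x \<in> carrier X \<Longrightarrow> copair D f g (in_r C X x) = g x"
    by (simp_all add: in_l_def in_r_def ev)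
  assume h: "h \<in> hoop_hom (coprod C X) D" "\<forall>c\<in>carrier C. h (in_l C X c) = f c"
    "\<forall>x\<in>carrier X. h (in_r C X x) = g x" and "t \<in> carrier (coprod C X)"
  then obtain s where s: "t = eq_class (coprod_eq C X) s" "s \<in> coprod_terms C X"
    by (auto simp: carrier_coprod)
  have "h (eq_class (coprod_eq C X) s) = hoop_eval D (case_sum f g) s"
    using s(2)
  proof (induction s)
    case (HGen x)
    then show ?case using h by (cases x) (auto simp: in_l_def in_r_def)
  next
    case HOne
    then show ?case using h by (simp add: hoop_hom_def coprod_one)
  next
    case (HMul s1 s2)
    then show ?case using h(1) by (simp add: hoop_hom_def flip: coprod_ops) (simp add: carrier_coprod)
  next
    case (HImp s1 s2)
    then show ?case using h(1) by (simp add: hoop_hom_def flip: coprod_ops) (simp add: carrier_coprod)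
  qed
  then show "h t = copair D f g t" using s ev by simp
qed


section \<open>The left adjoint of the forgetful functor\<close>

datatype (set_pterm: 'g) pterm =
    PGen 'g
  | POne
  | PZero
  | PMul "'g pterm" "'g pterm"  (infixl \<open>\<odot>\<^sub>p\<close> 70)
  | PImp "'g pterm" "'g pterm"  (infixr \<open>\<rightharpoonup>\<^sub>p\<close> 65)
  | PJoin "'g pterm" "'g pterm"  (infixl \<open>\<curlyvee>\<^sub>p\<close> 60)
  | PMeet "'g pterm" "'g pterm"  (infixl \<open>\<curlywedge>\<^sub>p\<close> 62)

inductive palg_law :: "'g pterm \<Rightarrow> 'g pterm \<Rightarrow> bool" where
  "palg_law ((x \<odot>\<^sub>p y) \<odot>\<^sub>p z) (x \<odot>\<^sub>p (y \<odot>\<^sub>p z))"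
| "palg_law (x \<odot>\<^sub>p y) (y \<odot>\<^sub>p x)"
| "palg_law (POne \<odot>\<^sub>p x) x"
| "palg_law ((x \<curlyvee>\<^sub>p y) \<curlyvee>\<^sub>p z) (x \<curlyvee>\<^sub>p (y \<curlyvee>\<^sub>p z))"
| "palg_law ((x \<curlywedge>\<^sub>p y) \<curlywedge>\<^sub>p z) (x \<curlywedge>\<^sub>p (y \<curlywedge>\<^sub>p z))"
| "palg_law (x \<curlyvee>\<^sub>p y) (y \<curlyvee>\<^sub>p x)"
| "palg_law (x \<curlywedge>\<^sub>p y) (y \<curlywedge>\<^sub>p x)"
| "palg_law (x \<curlyvee>\<^sub>p (x \<curlywedge>\<^sub>p y)) x"
| "palg_law (x \<curlywedge>\<^sub>p (x \<curlyvee>\<^sub>p y)) x"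
| "palg_law (PZero \<curlywedge>\<^sub>p x) PZero"
| "palg_law (x \<curlywedge>\<^sub>p POne) x"
| "palg_law (x \<curlywedge>\<^sub>p y) (x \<odot>\<^sub>p (x \<rightharpoonup>\<^sub>p y))"
| "palg_law ((x \<rightharpoonup>\<^sub>p y) \<curlyvee>\<^sub>p (y \<rightharpoonup>\<^sub>p x)) POne"
| "palg_law ((x \<rightharpoonup>\<^sub>p PZero) \<curlyvee>\<^sub>p ((x \<rightharpoonup>\<^sub>p (x \<odot>\<^sub>p y)) \<rightharpoonup>\<^sub>p y)) POne"

text \<open>The residuation law is not an equation; it enters \<open>free_eq\<close> as the pair of rules \<open>res1\<close>,
  \<open>res2\<close>.\<close>

definition free_terms :: "'x hoop \<Rightarrow> 'x pterm set" where
  "free_terms X = {t. set_pterm t \<subseteq> carrier X}"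

inductive free_eq :: "'x hoop \<Rightarrow> 'x pterm \<Rightarrow> 'x pterm \<Rightarrow> bool" for X where
  refl: "t \<in> free_terms X \<Longrightarrow> free_eq X t t"
| sym: "free_eq X t u \<Longrightarrow> free_eq X u t"
| trans: "free_eq X t u \<Longrightarrow> free_eq X u v \<Longrightarrow> free_eq X t v"
| mul: "free_eq X t t' \<Longrightarrow> free_eq X u u' \<Longrightarrow> free_eq X (t \<odot>\<^sub>p u) (t' \<odot>\<^sub>p u')"
| imp: "free_eq X t t' \<Longrightarrow> free_eq X u u' \<Longrightarrow> free_eq X (t \<rightharpoonup>\<^sub>p u) (t' \<rightharpoonup>\<^sub>p u')"
| join: "free_eq X t t' \<Longrightarrow> free_eq X u u' \<Longrightarrow> free_eq X (t \<curlyvee>\<^sub>p u) (t' \<curlyvee>\<^sub>p u')"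
| meet: "free_eq X t t' \<Longrightarrow> free_eq X u u' \<Longrightarrow> free_eq X (t \<curlywedge>\<^sub>p u) (t' \<curlywedge>\<^sub>p u')"
| law: "palg_law t u \<Longrightarrow> t \<in> free_terms X \<Longrightarrow> u \<in> free_terms X \<Longrightarrow> free_eq X t u"
| res1: "free_eq X ((t \<odot>\<^sub>p u) \<curlywedge>\<^sub>p v) (t \<odot>\<^sub>p u) \<Longrightarrow> free_eq X (t \<curlywedge>\<^sub>p (u \<rightharpoonup>\<^sub>p v)) t"
| res2: "free_eq X (t \<curlywedge>\<^sub>p (u \<rightharpoonup>\<^sub>p v)) t \<Longrightarrow> free_eq X ((t \<odot>\<^sub>p u) \<curlywedge>\<^sub>p v) (t \<odot>\<^sub>p u)"
| gen_one: "free_eq X (PGen \<one>\<^bsub>X\<^esub>) POne"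
| gen_mul: "x \<in> carrier X \<Longrightarrow> y \<in> carrier X
    \<Longrightarrow> free_eq X (PGen x \<odot>\<^sub>p PGen y) (PGen (x \<otimes>\<^bsub>X\<^esub> y))"
| gen_imp: "x \<in> carrier X \<Longrightarrow> y \<in> carrier X
    \<Longrightarrow> free_eq X (PGen x \<rightharpoonup>\<^sub>p PGen y) (PGen (x \<leadsto>\<^bsub>X\<^esub> y))"

definition K :: "'x hoop \<Rightarrow> 'x pterm set palg" where
  "K X = \<lparr>carrier = eq_class (free_eq X) ` free_terms X,
     mult = quot_op (free_eq X) (\<odot>\<^sub>p),
     one = eq_class (free_eq X) POne,
     imp = quot_op (free_eq X) (\<rightharpoonup>\<^sub>p),
     vee = quot_op (free_eq X) (\<curlyvee>\<^sub>p),
     wedge = quot_op (free_eq X) (\<curlywedge>\<^sub>p),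
     zero = eq_class (free_eq X) PZero\<rparr>"

definition eta :: "'x hoop \<Rightarrow> 'x \<Rightarrow> 'x pterm set" where
  "eta X x = eq_class (free_eq X) (PGen x)"

primrec palg_eval :: "'b palg \<Rightarrow> ('g \<Rightarrow> 'b) \<Rightarrow> 'g pterm \<Rightarrow> 'b" where
  "palg_eval B v (PGen g) = v g"
| "palg_eval B v POne = \<one>\<^bsub>B\<^esub>"
| "palg_eval B v PZero = \<zero>\<^bsub>B\<^esub>"
| "palg_eval B v (t \<odot>\<^sub>p u) = palg_eval B v t \<otimes>\<^bsub>B\<^esub> palg_eval B v u"
| "palg_eval B v (t \<rightharpoonup>\<^sub>p u) = palg_eval B v t \<leadsto>\<^bsub>B\<^esub> palg_eval B v u"
| "palg_eval B v (t \<curlyvee>\<^sub>p u) = palg_eval B v t \<curlyvee>\<^bsub>B\<^esub> palg_eval B v u"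
| "palg_eval B v (t \<curlywedge>\<^sub>p u) = palg_eval B v t \<curlywedge>\<^bsub>B\<^esub> palg_eval B v u"

text \<open>The transpose \<open>K X \<rightarrow> B\<close> of a hoop morphism \<open>f : X \<rightarrow> U B\<close>.\<close>

definition K_ext :: "'b palg \<Rightarrow> ('x \<Rightarrow> 'b) \<Rightarrow> 'x pterm set \<Rightarrow> 'b" where
  "K_ext B f S = palg_eval B f (SOME t. t \<in> S)"

definition K_map :: "'y hoop \<Rightarrow> ('x \<Rightarrow> 'y) \<Rightarrow> 'x pterm set \<Rightarrow> 'y pterm set" where
  "K_map Y f = K_ext (K Y) (\<lambda>x. eta Y (f x))"

lemma free_terms_simps [simp]:
  "POne \<in> free_terms X"
  "PZero \<in> free_terms X"
  "PGen x \<in> free_terms X \<longleftrightarrow> x \<in> carrier X"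
  "t \<odot>\<^sub>p u \<in> free_terms X \<longleftrightarrow> t \<in> free_terms X \<and> u \<in> free_terms X"
  "t \<rightharpoonup>\<^sub>p u \<in> free_terms X \<longleftrightarrow> t \<in> free_terms X \<and> u \<in> free_terms X"
  "t \<curlyvee>\<^sub>p u \<in> free_terms X \<longleftrightarrow> t \<in> free_terms X \<and> u \<in> free_terms X"
  "t \<curlywedge>\<^sub>p u \<in> free_terms X \<longleftrightarrow> t \<in> free_terms X \<and> u \<in> free_terms X"
  by (auto simp: free_terms_def)

lemma free_eq_in_terms:
  assumes "free_eq X t u" "product_hoop X"
  shows "t \<in> free_terms X \<and> u \<in> free_terms X"
proof -
  interpret X: product_hoop X by fact
  from assms(1) show ?thesis by induction auto
qed

lemma per_free_eq: "symp (free_eq X)" "transp (free_eq X)"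
  by (auto intro!: sympI transpI intro: free_eq.sym free_eq.trans)

lemma eq_class_free_eq:
  assumes "t \<in> free_terms X"
  shows "eq_class (free_eq X) t = eq_class (free_eq X) u \<longleftrightarrow> free_eq X t u"
  by (rule eq_class_eq_iff[OF per_free_eq free_eq.refl[OF assms]])

lemma K_ops:
  assumes "t \<in> free_terms X" "u \<in> free_terms X"
  shows "eq_class (free_eq X) t \<otimes>\<^bsub>K X\<^esub> eq_class (free_eq X) u = eq_class (free_eq X) (t \<odot>\<^sub>p u)"
    and "eq_class (free_eq X) t \<leadsto>\<^bsub>K X\<^esub> eq_class (free_eq X) u = eq_class (free_eq X) (t \<rightharpoonup>\<^sub>p u)"
    and "eq_class (free_eq X) t \<curlyvee>\<^bsub>K X\<^esub> eq_class (free_eq X) u = eq_class (free_eq X) (t \<curlyvee>\<^sub>p u)"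
    and "eq_class (free_eq X) t \<curlywedge>\<^bsub>K X\<^esub> eq_class (free_eq X) u = eq_class (free_eq X) (t \<curlywedge>\<^sub>p u)"
  using assms
  by (simp_all add: K_def quot_op_eq_class[OF per_free_eq] free_eq.refl free_eq.mul free_eq.imp
      free_eq.join free_eq.meet)

lemma K_consts: "\<one>\<^bsub>K X\<^esub> = eq_class (free_eq X) POne" "\<zero>\<^bsub>K X\<^esub> = eq_class (free_eq X) PZero"
  by (simp_all add: K_def)

lemma carrier_K: "carrier (K X) = eq_class (free_eq X) ` free_terms X"
  by (simp add: K_def)

lemma product_algebra_K: "product_algebra (K X)"
proof -
  interpret comm_monoid "K X"
    by (rule comm_monoidI)
      (auto simp: carrier_K K_consts K_ops eq_class_free_eq
        intro!: palg_law.intros[THEN free_eq.law] imageI del: equalityI)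
  show ?thesis
    by unfold_locales
      (auto simp: carrier_K K_consts K_ops eq_class_free_eq intro: free_eq.res1 free_eq.res2
        intro!: palg_law.intros[THEN free_eq.law] imageI del: equalityI)
qed

lemma palg_eval_closed:
  assumes "product_algebra B" "f \<in> hoop_hom X (U B)" "t \<in> free_terms X"
  shows "palg_eval B f t \<in> carrier B"
proof -
  interpret product_algebra B by fact
  from assms(3) show ?thesis by (induction t) (use assms(2) in \<open>auto simp: hoop_hom_def\<close>)
qed

lemma free_eq_sound:
  assumes X: "product_hoop X" and B: "product_algebra B" "f \<in> hoop_hom X (U B)"
    and "free_eq X t u"
  shows "palg_eval B f t = palg_eval B f u"
  using assms(4)
proof induction
  case (law t u)
  interpret B: product_algebra B by fact
  note cl = palg_eval_closed[OF B]
  from law show ?case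
    by cases
      (simp_all add: cl B.m_assoc B.join_assoc B.meet_assoc B.join_absorb B.meet_absorb
        B.zero_least B.one_greatest B.divisibility[symmetric] B.prelinearity B.product_axiom,
       (simp_all add: cl B.m_comm B.join_comm B.meet_comm)?)
next
  case (res1 t u v)
  interpret B: product_algebra B by fact
  from res1 show ?case
    using free_eq_in_terms[OF res1(1) X] by (simp add: B.residuation palg_eval_closed[OF B])
next
  case (res2 t u v)
  interpret B: product_algebra B by fact
  from res2 show ?case
    using free_eq_in_terms[OF res2(1) X] by (simp add: B.residuation palg_eval_closed[OF B])
qed (use B in \<open>auto simp: hoop_hom_def\<close>)

lemma K_ext_eq_class:
  assumes "product_hoop X" "product_algebra B" "f \<in> hoop_hom X (U B)" "t \<in> free_terms X"
  shows "K_ext B f (eq_class (free_eq X) t) = palg_eval B f t"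
  unfolding K_ext_def
  using free_eq_sound[OF assms(1-3) some_in_eq_class[of "free_eq X"], OF free_eq.refl] assms(4)
  by simp

text \<open>The universal property of \<open>eta X : X \<rightarrow> U (K X)\<close>.\<close>

lemma eta_hom:
  assumes "product_hoop X"
  shows "eta X \<in> hoop_hom X (U (K X))"
proof -
  interpret X: product_hoop X by fact
  show ?thesis
    by (auto simp: hoop_hom_def eta_def carrier_K K_consts K_ops eq_class_free_eq
        intro: free_eq.gen_one free_eq.sym[OF free_eq.gen_mul] free_eq.sym[OF free_eq.gen_imp]
        intro!: imageI del: equalityI)
qed

lemma K_ext:
  assumes "product_hoop X" "product_algebra B" "f \<in> hoop_hom X (U B)"
  shows K_ext_hom: "K_ext B f \<in> palg_hom (K X) B"
    and K_ext_eta: "x \<in> carrier X \<Longrightarrow> K_ext B f (eta X x) = f x"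
    and K_ext_unique: "h \<in> palg_hom (K X) B \<Longrightarrow> \<forall>x\<in>carrier X. h (eta X x) = f x
      \<Longrightarrow> t \<in> carrier (K X) \<Longrightarrow> h t = K_ext B f t"
proof -
  note ev = K_ext_eq_class[OF assms]
  show "K_ext B f \<in> palg_hom (K X) B"
    by (auto simp: palg_hom_def hoop_hom_def carrier_K K_consts K_ops ev
        palg_eval_closed[OF assms(2,3)])
  show "x \<in> carrier X \<Longrightarrow> K_ext B f (eta X x) = f x"
    by (simp add: eta_def ev)
  assume h: "h \<in> palg_hom (K X) B" "\<forall>x\<in>carrier X. h (eta X x) = f x" and "t \<in> carrier (K X)"
  then obtain s where s: "t = eq_class (free_eq X) s" "s \<in> free_terms X"
    by (auto simp: carrier_K)
  have "h (eq_class (free_eq X) s) = palg_eval B f s"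
    using s(2)
    by (induction s)
      (use h in \<open>simp_all add: palg_hom_def hoop_hom_def eta_def K_consts carrier_K flip: K_ops\<close>)
  then show "h t = K_ext B f t" using s ev by simp
qed


section \<open>Points and internal actions of product hoops\<close>

text \<open>The kernel of \<open>[id, 0] : C + X \<rightarrow> C\<close>, realised as a subalgebra of \<open>C + X\<close>; the kernel
  morphism \<open>\<kappa>\<close> is therefore the inclusion and leaves no trace in the formulas below.\<close>

definition flat :: "'c hoop \<Rightarrow> 'x hoop \<Rightarrow> ('c + 'x) hterm set hoop"  (infixr \<open>\<flat>\<close> 70) where
  "C \<flat> X = (coprod C X)\<lparr>carrier :=
     {t \<in> carrier (coprod C X). copair C (\<lambda>c. c) (\<lambda>_. \<one>\<^bsub>C\<^esub>) t = \<one>\<^bsub>C\<^esub>}\<rparr>"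

lemma product_hoop_flat:
  assumes "product_hoop C" "product_hoop X"
  shows "product_hoop (C \<flat> X)"
proof -
  interpret C: product_hoop C by fact
  interpret S: product_hoop "coprod C X" by (rule product_hoop_coprod)
  have ids: "(\<lambda>c. c) \<in> hoop_hom C C" "(\<lambda>_. \<one>\<^bsub>C\<^esub>) \<in> hoop_hom X C"
    by (auto simp: hoop_hom_def C.imp_self)
  note h = copair_hom[OF assms(1,2) assms(1) ids]
  have sub: "x \<in> carrier (coprod C X)" if "x \<in> carrier (C \<flat> X)" for x
    using that by (simp add: flat_def)
  have ops: "mult (C \<flat> X) = mult (coprod C X)" "imp (C \<flat> X) = imp (coprod C X)"
    "one (C \<flat> X) = one (coprod C X)"
    by (simp_all add: flat_def)
  have closed: "\<one>\<^bsub>coprod C X\<^esub> \<in> carrier (C \<flat> X)"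
    "\<lbrakk>x \<in> carrier (C \<flat> X); y \<in> carrier (C \<flat> X)\<rbrakk> \<Longrightarrow> x \<otimes>\<^bsub>coprod C X\<^esub> y \<in> carrier (C \<flat> X)"
    "\<lbrakk>x \<in> carrier (C \<flat> X); y \<in> carrier (C \<flat> X)\<rbrakk> \<Longrightarrow> x \<leadsto>\<^bsub>coprod C X\<^esub> y \<in> carrier (C \<flat> X)"
    for x y
    using h C.imp_self[of "\<one>\<^bsub>C\<^esub>"] by (simp_all add: flat_def hoop_hom_def)
  show ?thesis
    by (rule product_hoopI; unfold ops hoop_join_def hoop_meet_def;
        rule closed S.m_assoc S.m_comm S.l_one S.imp_self S.divisibility S.currying S.basic
          S.product_axiom[unfolded hoop_join_def hoop_meet_def];
        (rule sub)?; assumption)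
qed

text \<open>The morphism \<open>g + f : C + X \<rightarrow> D + Y\<close>. Its restriction to \<open>C \<flat> X\<close> is \<open>g \<flat> f\<close>.\<close>

definition coprod_map ::
    "'d hoop \<Rightarrow> 'y hoop \<Rightarrow> ('c \<Rightarrow> 'd) \<Rightarrow> ('x \<Rightarrow> 'y) \<Rightarrow> ('c + 'x) hterm set \<Rightarrow> ('d + 'y) hterm set" where
  "coprod_map D Y g f = copair (coprod D Y) (\<lambda>c. in_l D Y (g c)) (\<lambda>x. in_r D Y (f x))"

text \<open>The multiplication \<open>C \<flat> (C \<flat> X) \<rightarrow> C \<flat> X\<close>, a restriction of \<open>[in_l, \<kappa>]\<close>; the unit is \<open>in_r\<close>.\<close>

definition flat_mult ::
    "'c hoop \<Rightarrow> 'x hoop \<Rightarrow> ('c + ('c + 'x) hterm set) hterm set \<Rightarrow> ('c + 'x) hterm set" where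
  "flat_mult C X = copair (coprod C X) (in_l C X) (\<lambda>t. t)"

definition internal_action :: "'c hoop \<Rightarrow> 'x hoop \<Rightarrow> (('c + 'x) hterm set \<Rightarrow> 'x) \<Rightarrow> bool" where
  "internal_action C X \<xi> \<longleftrightarrow>
     \<xi> \<in> hoop_hom (C \<flat> X) X \<and>
     (\<forall>x\<in>carrier X. \<xi> (in_r C X x) = x) \<and>
     (\<forall>t\<in>carrier (C \<flat> (C \<flat> X)). \<xi> (flat_mult C X t) = \<xi> (coprod_map C X (\<lambda>c. c) \<xi> t))"

definition action_hom :: "'c hoop \<Rightarrow> 'x hoop \<Rightarrow> (('c + 'x) hterm set \<Rightarrow> 'x) \<Rightarrow>
    'y hoop \<Rightarrow> (('c + 'y) hterm set \<Rightarrow> 'y) \<Rightarrow> ('x \<Rightarrow> 'y) \<Rightarrow> bool" where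
  "action_hom C X \<xi> Y \<zeta> f \<longleftrightarrow>
     f \<in> hoop_hom X Y \<and>
     (\<forall>t\<in>carrier (C \<flat> X). f (\<xi> t) = \<zeta> (coprod_map C Y (\<lambda>c. c) f t))"

definition hoop_point :: "'c hoop \<Rightarrow> 'a hoop \<Rightarrow> ('a \<Rightarrow> 'c) \<Rightarrow> ('c \<Rightarrow> 'a) \<Rightarrow> bool" where
  "hoop_point C A p s \<longleftrightarrow> product_hoop A \<and>
     p \<in> hoop_hom A C \<and> s \<in> hoop_hom C A \<and> (\<forall>c\<in>carrier C. p (s c) = c)"

definition hoop_point_hom :: "'a hoop \<Rightarrow> ('a \<Rightarrow> 'c) \<Rightarrow> ('c \<Rightarrow> 'a) \<Rightarrow>
    'd hoop \<Rightarrow> ('d \<Rightarrow> 'c) \<Rightarrow> ('c \<Rightarrow> 'd) \<Rightarrow> 'c hoop \<Rightarrow> ('a \<Rightarrow> 'd) \<Rightarrow> bool" where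
  "hoop_point_hom A p s D q r C h \<longleftrightarrow> h \<in> hoop_hom A D \<and>
     (\<forall>a\<in>carrier A. q (h a) = p a) \<and> (\<forall>c\<in>carrier C. h (s c) = r c)"

definition is_kernel :: "'x hoop \<Rightarrow> 'a hoop \<Rightarrow> 'c hoop \<Rightarrow> ('a \<Rightarrow> 'c) \<Rightarrow> ('x \<Rightarrow> 'a) \<Rightarrow> bool" where
  "is_kernel X A C p k \<longleftrightarrow> k \<in> hoop_hom X A \<and> inj_on k (carrier X) \<and>
     k ` carrier X = {a \<in> carrier A. p a = \<one>\<^bsub>C\<^esub>}"

lemma is_kernel_factors:
  assumes k: "is_kernel X A C p k" and f: "f \<in> hoop_hom Z A" "\<forall>z\<in>carrier Z. p (f z) = \<one>\<^bsub>C\<^esub>"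
    and X: "product_hoop X" and Z: "product_hoop Z"
  shows "\<exists>g\<in>hoop_hom Z X. \<forall>z\<in>carrier Z. k (g z) = f z"
proof -
  interpret X: product_hoop X by fact
  interpret Z: product_hoop Z by fact
  define g where "g z = inv_into (carrier X) k (f z)" for z
  have im: "f z \<in> k ` carrier X" if "z \<in> carrier Z" for z
    using that k f by (auto simp: is_kernel_def hoop_hom_def)
  have g: "g z \<in> carrier X" "k (g z) = f z" if "z \<in> carrier Z" for z
    using im[OF that] unfolding g_def by (auto intro: inv_into_into f_inv_into_f)
  have uniq: "g z = x" if "z \<in> carrier Z" "x \<in> carrier X" "k x = f z" for z x
    using k g[OF that(1)] that(2,3) inj_onD[of k "carrier X" "g z" x] by (simp add: is_kernel_def)
  have k_ops: "k \<one>\<^bsub>X\<^esub> = \<one>\<^bsub>A\<^esub>"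
    "\<lbrakk>x \<in> carrier X; y \<in> carrier X\<rbrakk> \<Longrightarrow> k (x \<otimes>\<^bsub>X\<^esub> y) = k x \<otimes>\<^bsub>A\<^esub> k y"
    "\<lbrakk>x \<in> carrier X; y \<in> carrier X\<rbrakk> \<Longrightarrow> k (x \<leadsto>\<^bsub>X\<^esub> y) = k x \<leadsto>\<^bsub>A\<^esub> k y" for x y
    using k by (auto simp: is_kernel_def hoop_hom_def)
  have f_ops: "f \<one>\<^bsub>Z\<^esub> = \<one>\<^bsub>A\<^esub>"
    "\<lbrakk>x \<in> carrier Z; y \<in> carrier Z\<rbrakk> \<Longrightarrow> f (x \<otimes>\<^bsub>Z\<^esub> y) = f x \<otimes>\<^bsub>A\<^esub> f y"
    "\<lbrakk>x \<in> carrier Z; y \<in> carrier Z\<rbrakk> \<Longrightarrow> f (x \<leadsto>\<^bsub>Z\<^esub> y) = f x \<leadsto>\<^bsub>A\<^esub> f y" for x y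
    using f(1) by (auto simp: hoop_hom_def)
  have "g \<in> hoop_hom Z X"
    unfolding hoop_hom_def
    by (intro CollectI conjI ballI uniq funcsetI) (simp_all add: k_ops f_ops g)
  then show ?thesis using g(2) by blast
qed

text \<open>The point \<open>(p, s)\<close> over \<open>C\<close> is associated with \<open>\<xi>\<close>, as witnessed by the kernel \<open>k\<close> of \<open>p\<close>.\<close>

definition associated_via :: "'c hoop \<Rightarrow> 'x hoop \<Rightarrow> (('c + 'x) hterm set \<Rightarrow> 'x) \<Rightarrow>
    'a hoop \<Rightarrow> ('a \<Rightarrow> 'c) \<Rightarrow> ('c \<Rightarrow> 'a) \<Rightarrow> ('x \<Rightarrow> 'a) \<Rightarrow> bool" where
  "associated_via C X \<xi> A p s k \<longleftrightarrow> hoop_point C A p s \<and> is_kernel X A C p k \<and>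
     (\<forall>t\<in>carrier (C \<flat> X). k (\<xi> t) = copair A s k t)"


section \<open>Coherent and ideal relative actions\<close>

text \<open>\<open>K0\<close> is \<open>F(0)\<close>, the product algebra freely generated by the trivial hoop, and \<open>iota B\<close> is the
  unique morphism \<open>K0 \<rightarrow> B\<close>, the transpose of \<open>0 \<rightarrow> U B\<close>. In \<open>is_xi0\<close>, the first component
  \<open>K_map X (\<lambda>_. \<one>)\<close> of the copairing is \<open>UF\<close> applied to \<open>0 \<rightarrow> X\<close>.\<close>

abbreviation K0 :: "unit pterm set palg" where
  "K0 \<equiv> K trivial_hoop"

definition iota :: "'b palg \<Rightarrow> unit pterm set \<Rightarrow> 'b" where
  "iota B = K_ext B (\<lambda>_. \<one>\<^bsub>B\<^esub>)"

definition is_xi0 :: "'x hoop \<Rightarrow> ((unit pterm set + 'x) hterm set \<Rightarrow> 'x) \<Rightarrow> bool" where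
  "is_xi0 X \<xi>0 \<longleftrightarrow> internal_action (U K0) X \<xi>0 \<and>
     (\<forall>t\<in>carrier (U K0 \<flat> X).
        eta X (\<xi>0 t) = copair (U (K X)) (K_map X (\<lambda>_. \<one>\<^bsub>X\<^esub>)) (eta X) t)"

definition coherent_action ::
    "'b palg \<Rightarrow> 'x hoop \<Rightarrow> (('b + 'x) hterm set \<Rightarrow> 'x) \<Rightarrow> bool" where
  "coherent_action B X \<xi> \<longleftrightarrow> internal_action (U B) X \<xi> \<and>
     (\<exists>\<xi>0. is_xi0 X \<xi>0 \<and>
        (\<forall>t\<in>carrier (U K0 \<flat> X). \<xi> (coprod_map (U B) X (iota B) (\<lambda>x. x) t) = \<xi>0 t))"

definition palg_point :: "'b palg \<Rightarrow> 'a palg \<Rightarrow> ('a \<Rightarrow> 'b) \<Rightarrow> ('b \<Rightarrow> 'a) \<Rightarrow> bool" where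
  "palg_point B A p s \<longleftrightarrow> product_algebra A \<and>
     p \<in> palg_hom A B \<and> s \<in> palg_hom B A \<and> (\<forall>b\<in>carrier B. p (s b) = b)"

definition palg_point_hom :: "'a palg \<Rightarrow> ('a \<Rightarrow> 'b) \<Rightarrow> ('b \<Rightarrow> 'a) \<Rightarrow>
    'd palg \<Rightarrow> ('d \<Rightarrow> 'b) \<Rightarrow> ('b \<Rightarrow> 'd) \<Rightarrow> 'b palg \<Rightarrow> ('a \<Rightarrow> 'd) \<Rightarrow> bool" where
  "palg_point_hom A p s D q r B h \<longleftrightarrow> h \<in> palg_hom A D \<and>
     (\<forall>a\<in>carrier A. q (h a) = p a) \<and> (\<forall>b\<in>carrier B. h (s b) = r b)"

text \<open>The point \<open>(p', s')\<close> of product algebras over \<open>B\<close> corresponds to the point \<open>(p, s)\<close> of product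
  hoops over \<open>U B\<close> via the isomorphism \<open>\<sigma> : U A' \<rightarrow> A\<close>. Up to isomorphism, \<open>A'\<close> may be taken on the
  type of \<open>A\<close>.\<close>

definition ideal_via :: "'b palg \<Rightarrow> 'a hoop \<Rightarrow> ('a \<Rightarrow> 'b) \<Rightarrow> ('b \<Rightarrow> 'a) \<Rightarrow>
    'a palg \<Rightarrow> ('a \<Rightarrow> 'b) \<Rightarrow> ('b \<Rightarrow> 'a) \<Rightarrow> ('a \<Rightarrow> 'a) \<Rightarrow> bool" where
  "ideal_via B A p s A' p' s' \<sigma> \<longleftrightarrow> palg_point B A' p' s' \<and>
     \<sigma> \<in> hoop_hom (U A') A \<and> bij_betw \<sigma> (carrier A') (carrier A) \<and>
     (\<forall>a\<in>carrier A'. p (\<sigma> a) = p' a) \<and> (\<forall>b\<in>carrier B. \<sigma> (s' b) = s b)"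

definition ideal_point :: "'b palg \<Rightarrow> 'a hoop \<Rightarrow> ('a \<Rightarrow> 'b) \<Rightarrow> ('b \<Rightarrow> 'a) \<Rightarrow> bool" where
  "ideal_point B A p s \<longleftrightarrow> hoop_point (U B) A p s \<and> (\<exists>A' p' s' \<sigma>. ideal_via B A p s A' p' s' \<sigma>)"

definition ideal_point_hom :: "'b palg \<Rightarrow> 'a hoop \<Rightarrow> ('a \<Rightarrow> 'b) \<Rightarrow> ('b \<Rightarrow> 'a) \<Rightarrow>
    'd hoop \<Rightarrow> ('d \<Rightarrow> 'b) \<Rightarrow> ('b \<Rightarrow> 'd) \<Rightarrow> ('a \<Rightarrow> 'd) \<Rightarrow> bool" where
  "ideal_point_hom B A p s D q r h \<longleftrightarrow> hoop_point_hom A p s D q r (U B) h \<and>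
     (\<exists>A' p' s' \<sigma> D' q' r' \<rho> h'.
        ideal_via B A p s A' p' s' \<sigma> \<and> ideal_via B D q r D' q' r' \<rho> \<and>
        palg_point_hom A' p' s' D' q' r' B h' \<and> (\<forall>a\<in>carrier A'. h (\<sigma> a) = \<rho> (h' a)))"

text \<open>A formula of HOL cannot quantify over types, so the types on which the structures live are
  passed as parameters in the remaining definitions. An action has at most one associated point up
  to isomorphism; \<open>ideal_action\<close> asks that every associated point, on the given type, be ideal.\<close>

definition ideal_action ::
    "'a itself \<Rightarrow> 'b palg \<Rightarrow> 'x hoop \<Rightarrow> (('b + 'x) hterm set \<Rightarrow> 'x) \<Rightarrow> bool" where
  "ideal_action TA B X \<xi> \<longleftrightarrow>
     (\<forall>(A :: 'a hoop) p s k. associated_via (U B) X \<xi> A p s k \<longrightarrow> ideal_point B A p s)"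

text \<open>The morphism of points corresponding to a morphism \<open>f\<close> of actions is the one that restricts
  to \<open>f\<close> on the kernels.\<close>

definition ideal_action_hom :: "'a itself \<Rightarrow> 'd itself \<Rightarrow> 'b palg \<Rightarrow>
    'x hoop \<Rightarrow> (('b + 'x) hterm set \<Rightarrow> 'x) \<Rightarrow> 'y hoop \<Rightarrow> (('b + 'y) hterm set \<Rightarrow> 'y) \<Rightarrow>
    ('x \<Rightarrow> 'y) \<Rightarrow> bool" where
  "ideal_action_hom TA TD B X \<xi> Y \<zeta> f \<longleftrightarrow>
     (\<forall>(A :: 'a hoop) p s k (D :: 'd hoop) q r l h.
        associated_via (U B) X \<xi> A p s k \<longrightarrow> associated_via (U B) Y \<zeta> D q r l \<longrightarrow>
        hoop_point_hom A p s D q r (U B) h \<longrightarrow> (\<forall>x\<in>carrier X. h (k x) = l (f x)) \<longrightarrow>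
        ideal_point_hom B A p s D q r h)"

definition BAT :: "'b itself \<Rightarrow> 'x itself \<Rightarrow> 'y itself \<Rightarrow> 'a itself \<Rightarrow> 'd itself \<Rightarrow> bool" where
  "BAT TB TX TY TA TD \<longleftrightarrow>
     (\<forall>(B :: 'b palg) (X :: 'x hoop) \<xi>.
        product_algebra B \<longrightarrow> product_hoop X \<longrightarrow> coherent_action B X \<xi> \<longrightarrow> ideal_action TA B X \<xi>) \<and>
     (\<forall>(B :: 'b palg) (X :: 'x hoop) \<xi> (Y :: 'y hoop) \<zeta> f.
        product_algebra B \<longrightarrow> product_hoop X \<longrightarrow> product_hoop Y \<longrightarrow>
        coherent_action B X \<xi> \<longrightarrow> coherent_action B Y \<zeta> \<longrightarrow> action_hom (U B) X \<xi> Y \<zeta> f \<longrightarrow>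
        ideal_action_hom TA TD B X \<xi> Y \<zeta> f)"

end

theory Submission
  imports Defs
begin

text \<open>Let \<open>(p, s)\<close> be a point over \<open>U B\<close> associated with a coherent action, with kernel
  \<open>k : X \<rightarrow> A\<close>. Everything follows once \<open>s 0\<close> is known to be the least element of \<open>A\<close>. A product
  hoop with a least element is a product algebra (\<open>product_algebra_palg_of\<close>), and a hoop morphism
  between product algebras that preserves \<open>0\<close> preserves all operations (\<open>palg_homI\<close>), because the
  lattice operations are determined by the hoop structure. Hence \<open>A\<close> itself, with \<open>s 0\<close> as zero,
  is a product algebra, and \<open>p\<close>, \<open>s\<close> and every morphism of such points are morphisms of product
  algebras; the isomorphisms \<open>\<sigma>\<close> in the definition of ideality are identities.

  Coherence enters as follows. The action \<open>\<xi>0\<close> is computed inside \<open>K X\<close>, where \<open>0 \<leadsto> eta x = 1\<close>;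
  since \<open>eta\<close> has trivial kernel, \<open>\<xi>0\<close> sends the term \<open>0 \<leadsto> x\<close> to \<open>1\<close>, by coherence so does
  \<open>\<xi>\<close>, and therefore \<open>s 0 \<leadsto> k x = 1\<close>: the element \<open>s 0\<close> lies below the kernel of \<open>p\<close>. For an
  arbitrary \<open>a\<close> in \<open>A\<close> the element \<open>s 0 \<leadsto> a\<close> is in the kernel, since \<open>p\<close> sends it to
  \<open>0 \<leadsto> p a = 1\<close>. As \<open>s 0\<close> is idempotent, \<open>s 0 \<leadsto> a = s 0 \<leadsto> (s 0 \<leadsto> a) = 1\<close>.

  The substantial step is that \<open>eta\<close> has trivial kernel (\<open>eta_trivial_kernel\<close>). For this it is
  enough to separate a given \<open>c \<noteq> 1\<close> from \<open>1\<close> by a hoop morphism into a product algebra. A filter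
  maximal among those that avoid \<open>c\<close> is prime (\<open>maximal_filter_prime\<close>), so the quotient by it is
  linearly ordered. If the quotient has a least element, it is a product algebra. Otherwise the
  product axiom makes it cancellative, and adjoining a new bottom yields a product algebra
  (\<open>product_hoop_with_bottom\<close>).\<close>


section \<open>The natural order of a hoop\<close>

context hoop
begin

abbreviation le (infix \<open>\<preceq>\<close> 50) where
  "x \<preceq> y \<equiv> x \<leadsto> y = \<one>"

abbreviation join (infixl \<open>\<or>\<^sub>h\<close> 60) where
  "x \<or>\<^sub>h y \<equiv> hoop_join H x y"

text \<open>Both facts are proved together: \<open>\<one> \<leadsto> x = x \<otimes> (x \<leadsto> \<one>)\<close> by divisibility, so elements of the
  form \<open>\<one> \<leadsto> x\<close> lie below \<open>\<one>\<close>. This applies to \<open>x \<leadsto> \<one>\<close>, which equals \<open>\<one> \<leadsto> (x \<leadsto> \<one>)\<close>, and with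
  it one finds that \<open>\<one> \<leadsto> x\<close> and \<open>x\<close> lie below each other.\<close>

lemma le_one_and_one_imp:
  assumes x: "x \<in> carrier H"
  shows "x \<preceq> \<one>" and "\<one> \<leadsto> x = x"
proof -
  define y where "y = \<one> \<leadsto> x"
  define e where "e = x \<leadsto> \<one>"
  have c: "y \<in> carrier H" "e \<in> carrier H" using x by (auto simp: y_def e_def)
  have div1: "\<one> \<leadsto> z = z \<otimes> (z \<leadsto> \<one>)" if "z \<in> carrier H" for z
    using divisibility[of \<one> z] that by simp
  have below_one: "(\<one> \<leadsto> z) \<leadsto> \<one> = \<one>" if "z \<in> carrier H" for z
    using that div1[OF that] currying[of "z \<leadsto> \<one>" z \<one>] by (simp add: imp_self m_comm)
  have "\<one> \<leadsto> e = e"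
    using currying[of \<one> x \<one>] x by (simp add: e_def)
  then have e1: "e \<preceq> \<one>" using below_one[of e] c by simp
  have "y \<preceq> x"
    using div1[OF x] currying[of e x x] c x e1 by (simp add: y_def imp_self m_comm flip: e_def)
  moreover have "x \<preceq> y"
    using currying[of x \<one> x] x by (simp add: y_def imp_self)
  ultimately show *: "\<one> \<leadsto> x = x"
    using divisibility[of x y] x c by (simp add: y_def)
  show "x \<preceq> \<one>" using below_one[OF x] * by simp
qed

lemmas le_one [simp] = le_one_and_one_imp(1)
lemmas one_imp [simp] = le_one_and_one_imp(2)
declare imp_self [simp]

lemma le_antisym: "\<lbrakk>x \<preceq> y; y \<preceq> x; x \<in> carrier H; y \<in> carrier H\<rbrakk> \<Longrightarrow> x = y"
  using divisibility[of x y] by simp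

lemma le_trans:
  assumes "x \<preceq> y" "y \<preceq> z" and c: "x \<in> carrier H" "y \<in> carrier H" "z \<in> carrier H"
  shows "x \<preceq> z"
proof -
  have "x = (y \<leadsto> x) \<otimes> y" using divisibility[of x y] assms by (simp add: m_comm)
  then have "x \<leadsto> z = (y \<leadsto> x) \<leadsto> (y \<leadsto> z)" using currying[of "y \<leadsto> x" y z] c by simp
  then show ?thesis using assms by simp
qed

lemma residuation:
  "\<lbrakk>x \<in> carrier H; y \<in> carrier H; z \<in> carrier H\<rbrakk> \<Longrightarrow> x \<otimes> y \<preceq> z \<longleftrightarrow> x \<preceq> y \<leadsto> z"
  by (simp add: currying)

lemma imp_swap:
  "\<lbrakk>x \<in> carrier H; y \<in> carrier H; z \<in> carrier H\<rbrakk> \<Longrightarrow> x \<leadsto> (y \<leadsto> z) = y \<leadsto> (x \<leadsto> z)"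
  by (metis currying m_comm)

lemma le_imp_imp: "\<lbrakk>x \<in> carrier H; y \<in> carrier H\<rbrakk> \<Longrightarrow> x \<preceq> (x \<leadsto> y) \<leadsto> y"
  by (simp add: imp_swap[of x "x \<leadsto> y" y])

lemma le_imp: "\<lbrakk>x \<in> carrier H; y \<in> carrier H\<rbrakk> \<Longrightarrow> x \<preceq> y \<leadsto> x"
  by (simp add: imp_swap[of x y x])

lemma mult_le:
  assumes "x \<in> carrier H" "y \<in> carrier H"
  shows "x \<otimes> y \<preceq> x" and "x \<otimes> y \<preceq> y"
  using assms by (simp_all add: currying le_imp)

lemma mult_mono:
  assumes "x \<preceq> y" and c: "x \<in> carrier H" "y \<in> carrier H" "z \<in> carrier H"
  shows "z \<otimes> x \<preceq> z \<otimes> y"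
proof -
  have "y \<preceq> z \<leadsto> (z \<otimes> y)" using c residuation[of y z "z \<otimes> y"] by (simp add: m_comm)
  then have "x \<preceq> z \<leadsto> (z \<otimes> y)" using assms le_trans[of x y] by simp
  then show ?thesis using c residuation[of x z "z \<otimes> y"] by (simp add: m_comm)
qed

lemma imp_mono:
  assumes "x \<preceq> y" and c: "x \<in> carrier H" "y \<in> carrier H" "z \<in> carrier H"
  shows "z \<leadsto> x \<preceq> z \<leadsto> y"
proof -
  have "(z \<leadsto> x) \<otimes> z \<preceq> x" using c by (simp add: currying)
  then have "(z \<leadsto> x) \<otimes> z \<preceq> y" using assms le_trans[of "(z \<leadsto> x) \<otimes> z" x y] by simp
  then show ?thesis using c by (simp add: currying)
qed

lemma imp_trans:
  assumes c: "x \<in> carrier H" "y \<in> carrier H" "z \<in> carrier H"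
  shows "x \<leadsto> y \<preceq> (y \<leadsto> z) \<leadsto> (x \<leadsto> z)"
proof -
  have "y \<leadsto> z \<preceq> (x \<leadsto> y) \<leadsto> (x \<leadsto> z)"
  proof -
    have "y \<preceq> (y \<leadsto> z) \<leadsto> z" by (rule le_imp_imp[OF c(2,3)])
    then have "x \<leadsto> y \<preceq> x \<leadsto> ((y \<leadsto> z) \<leadsto> z)" by (rule imp_mono) (use c in auto)
    moreover have "x \<leadsto> ((y \<leadsto> z) \<leadsto> z) = (y \<leadsto> z) \<leadsto> (x \<leadsto> z)"
      using c imp_swap[of x "y \<leadsto> z" z] by simp
    ultimately show ?thesis using c imp_swap[of "y \<leadsto> z" "x \<leadsto> y" "x \<leadsto> z"] by simp
  qed
  then show ?thesis using c imp_swap[of "y \<leadsto> z" "x \<leadsto> y" "x \<leadsto> z"] by simp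
qed

lemma mult_imp_mult:
  assumes c: "x \<in> carrier H" "y \<in> carrier H" "z \<in> carrier H"
  shows "x \<leadsto> y \<preceq> (x \<otimes> z) \<leadsto> (y \<otimes> z)"
proof -
  have "((x \<leadsto> y) \<otimes> x) \<preceq> y" using c by (simp add: currying)
  then have "z \<otimes> ((x \<leadsto> y) \<otimes> x) \<preceq> z \<otimes> y" by (rule mult_mono) (use c in auto)
  then have "(x \<leadsto> y) \<otimes> (x \<otimes> z) \<preceq> y \<otimes> z"
    using c by (simp only: m_ac m_closed imp_closed)
  then show ?thesis using c currying[of "x \<leadsto> y" "x \<otimes> z" "y \<otimes> z"] by simp
qed

lemma meet_in_carrier [simp]:
  "\<lbrakk>x \<in> carrier H; y \<in> carrier H\<rbrakk> \<Longrightarrow> hoop_meet H x y \<in> carrier H"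
  by (simp add: hoop_meet_def)

lemma join_in_carrier [simp]: "\<lbrakk>x \<in> carrier H; y \<in> carrier H\<rbrakk> \<Longrightarrow> x \<or>\<^sub>h y \<in> carrier H"
  by (simp add: hoop_join_def)

lemma meet_comm: "\<lbrakk>x \<in> carrier H; y \<in> carrier H\<rbrakk> \<Longrightarrow> hoop_meet H x y = hoop_meet H y x"
  by (simp add: hoop_meet_def divisibility)

lemma join_comm: "\<lbrakk>x \<in> carrier H; y \<in> carrier H\<rbrakk> \<Longrightarrow> x \<or>\<^sub>h y = y \<or>\<^sub>h x"
  by (simp add: hoop_join_def meet_comm)

lemma meet_lower:
  assumes "x \<in> carrier H" "y \<in> carrier H"
  shows "hoop_meet H x y \<preceq> x" and "hoop_meet H x y \<preceq> y"
proof -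
  have *: "hoop_meet H a b \<preceq> a" if "a \<in> carrier H" "b \<in> carrier H" for a b
    using that mult_le by (simp add: hoop_meet_def)
  show "hoop_meet H x y \<preceq> x" "hoop_meet H x y \<preceq> y"
    using *[of x y] *[of y x] assms meet_comm[of x y] by simp_all
qed

text \<open>Divisibility writes an element \<open>z\<close> below \<open>x\<close> as \<open>x \<otimes> (x \<leadsto> z)\<close>, which is monotone in \<open>z\<close>.\<close>

lemma meet_greatest:
  assumes "z \<preceq> x" "z \<preceq> y" and c: "x \<in> carrier H" "y \<in> carrier H" "z \<in> carrier H"
  shows "z \<preceq> hoop_meet H x y"
proof -
  have "z = x \<otimes> (x \<leadsto> z)" using divisibility[of x z] assms by simp
  moreover have "x \<otimes> (x \<leadsto> z) \<preceq> x \<otimes> (x \<leadsto> y)"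
    using assms by (intro mult_mono imp_mono) auto
  ultimately show ?thesis by (simp add: hoop_meet_def)
qed

lemma le_iff_meet: "\<lbrakk>x \<in> carrier H; y \<in> carrier H\<rbrakk> \<Longrightarrow> hoop_meet H x y = x \<longleftrightarrow> x \<preceq> y"
  by (metis hoop_meet_def meet_lower(2) imp_closed r_one)

lemma join_upper:
  assumes "x \<in> carrier H" "y \<in> carrier H"
  shows "x \<preceq> x \<or>\<^sub>h y" and "y \<preceq> x \<or>\<^sub>h y"
  using assms by (simp_all add: hoop_join_def meet_greatest le_imp_imp le_imp)

lemma join_eq_one_imp:
  assumes "x \<or>\<^sub>h y = \<one>" "x \<preceq> y" and c: "x \<in> carrier H" "y \<in> carrier H"
  shows "y = \<one>"
  using meet_lower(1)[of "(x \<leadsto> y) \<leadsto> y" "(y \<leadsto> x) \<leadsto> x"] assms by (simp add: hoop_join_def)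

end

context basic_hoop
begin

text \<open>The basic axiom in the form of a case distinction between \<open>x \<leadsto> y\<close> and \<open>y \<leadsto> x\<close>, as if one of
  them were \<open>\<one>\<close>.\<close>

lemma le_by_prelinearity:
  assumes "x \<leadsto> y \<preceq> z" "y \<leadsto> x \<preceq> z" and c: "x \<in> carrier H" "y \<in> carrier H" "z \<in> carrier H"
  shows "z = \<one>"
  using basic[of x y z] assms by simp

text \<open>The term \<open>\<or>\<^sub>h\<close> is an upper bound in any hoop; that it is the least one needs the basic axiom.
  With \<open>j = x \<or>\<^sub>h y\<close>, its two factors give \<open>j \<otimes> (x \<leadsto> y) \<preceq> y \<preceq> z\<close> and \<open>j \<otimes> (y \<leadsto> x) \<preceq> x \<preceq> z\<close>,
  so both \<open>x \<leadsto> y\<close> and \<open>y \<leadsto> x\<close> lie below \<open>j \<leadsto> z\<close>.\<close>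

lemma join_least:
  assumes "x \<preceq> z" "y \<preceq> z" and c: "x \<in> carrier H" "y \<in> carrier H" "z \<in> carrier H"
  shows "x \<or>\<^sub>h y \<preceq> z"
proof (rule le_by_prelinearity[of x y])
  let ?j = "x \<or>\<^sub>h y"
  have *: "a \<preceq> ?j \<leadsto> z"
    if "?j \<preceq> a \<leadsto> b" "b \<preceq> z" "a \<in> carrier H" "b \<in> carrier H" for a b
  proof -
    have "?j \<preceq> a \<leadsto> z"
      using that c le_trans[of ?j "a \<leadsto> b" "a \<leadsto> z"] imp_mono[of b z a] by simp
    then show ?thesis using that c by (simp add: imp_swap)
  qed
  show "x \<leadsto> y \<preceq> ?j \<leadsto> z"
    by (rule *[of _ y]) (use c assms in \<open>simp_all add: hoop_join_def meet_lower\<close>)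
  show "y \<leadsto> x \<preceq> ?j \<leadsto> z"
    by (rule *[of _ x]) (use c assms in \<open>simp_all add: hoop_join_def meet_lower\<close>)
qed (use c in auto)

lemma prelinearity:
  assumes "x \<in> carrier H" "y \<in> carrier H"
  shows "(x \<leadsto> y) \<or>\<^sub>h (y \<leadsto> x) = \<one>"
  by (rule le_by_prelinearity[of x y]) (use assms in \<open>simp_all add: join_upper\<close>)

end


section \<open>Product hoops with a least element\<close>

definition palg_of :: "'a hoop \<Rightarrow> 'a \<Rightarrow> 'a palg" where
  "palg_of H z = \<lparr>carrier = carrier H, mult = mult H, one = one H, imp = imp H,
     vee = hoop_join H, wedge = hoop_meet H, zero = z\<rparr>"

lemma palg_of_simps [simp]:
  "carrier (palg_of H z) = carrier H" "mult (palg_of H z) = mult H" "one (palg_of H z) = one H"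
  "imp (palg_of H z) = imp H" "vee (palg_of H z) = hoop_join H"
  "wedge (palg_of H z) = hoop_meet H" "zero (palg_of H z) = z"
  by (simp_all add: palg_of_def)

lemma U_palg_of [simp]: "U (palg_of H z) = H"
  by (simp add: U_def)

lemma product_algebra_palg_of:
  fixes H :: "'a hoop" (structure)
  assumes "product_hoop H" and z: "z \<in> carrier H" "\<And>x. x \<in> carrier H \<Longrightarrow> z \<leadsto> x = \<one>"
  shows "product_algebra (palg_of H z)"
proof -
  interpret product_hoop H by fact
  interpret A: comm_monoid "palg_of H z"
    by (rule comm_monoidI) (auto simp: m_assoc intro: m_comm)
  have jassoc1: "(x \<or>\<^sub>h y) \<or>\<^sub>h w \<preceq> x \<or>\<^sub>h (y \<or>\<^sub>h w)"
    if c: "x \<in> carrier H" "y \<in> carrier H" "w \<in> carrier H" for x y w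
  proof -
    have "y \<preceq> x \<or>\<^sub>h (y \<or>\<^sub>h w)" "w \<preceq> x \<or>\<^sub>h (y \<or>\<^sub>h w)"
      using c le_trans[of _ "y \<or>\<^sub>h w" "x \<or>\<^sub>h (y \<or>\<^sub>h w)"] join_upper by simp_all
    then show ?thesis using c join_upper by (simp add: join_least)
  qed
  have massoc1: "hoop_meet H (hoop_meet H x y) w \<preceq> hoop_meet H x (hoop_meet H y w)"
    if c: "x \<in> carrier H" "y \<in> carrier H" "w \<in> carrier H" for x y w
  proof -
    let ?m = "hoop_meet H (hoop_meet H x y) w"
    have "?m \<preceq> x" "?m \<preceq> y"
      using c le_trans[of ?m "hoop_meet H x y"] meet_lower by simp_all
    then show ?thesis using c meet_lower by (simp add: meet_greatest)
  qed
  show ?thesis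
  proof (unfold_locales, simp_all)
    fix x y w assume c: "x \<in> carrier H" "y \<in> carrier H"
    show "x \<or>\<^sub>h y = y \<or>\<^sub>h x" by (rule join_comm[OF c])
    show "hoop_meet H x y = hoop_meet H y x" by (rule meet_comm[OF c])
    show "x \<or>\<^sub>h hoop_meet H x y = x"
      using le_antisym[OF join_least[of x x "hoop_meet H x y"] join_upper(1)] c
      by (simp add: meet_lower)
    show "hoop_meet H x (x \<or>\<^sub>h y) = x" using c by (simp add: le_iff_meet join_upper)
    show "hoop_meet H x y = x \<otimes> (x \<leadsto> y)" by (simp add: hoop_meet_def)
    show "(x \<leadsto> y) \<or>\<^sub>h (y \<leadsto> x) = \<one>" by (rule prelinearity[OF c])
    show "(x \<leadsto> z) \<or>\<^sub>h ((x \<leadsto> x \<otimes> y) \<leadsto> y) = \<one>"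
      using product_axiom[of y x z] c z by (simp add: m_comm)
    assume w: "w \<in> carrier H"
    show "(x \<or>\<^sub>h y) \<or>\<^sub>h w = x \<or>\<^sub>h (y \<or>\<^sub>h w)"
    proof (rule le_antisym)
      have "x \<or>\<^sub>h (y \<or>\<^sub>h w) = (w \<or>\<^sub>h y) \<or>\<^sub>h x" "(x \<or>\<^sub>h y) \<or>\<^sub>h w = w \<or>\<^sub>h (y \<or>\<^sub>h x)"
        using c w by (simp_all add: join_comm)
      then show "x \<or>\<^sub>h (y \<or>\<^sub>h w) \<preceq> (x \<or>\<^sub>h y) \<or>\<^sub>h w" using jassoc1[of w y x] c w by simp
    qed (use c w jassoc1 in auto)
    show "hoop_meet H (hoop_meet H x y) w = hoop_meet H x (hoop_meet H y w)"
    proof (rule le_antisym)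
      have "hoop_meet H x (hoop_meet H y w) = hoop_meet H (hoop_meet H w y) x"
        "hoop_meet H (hoop_meet H x y) w = hoop_meet H w (hoop_meet H y x)"
        using c w by (simp_all add: meet_comm)
      then show "hoop_meet H x (hoop_meet H y w) \<preceq> hoop_meet H (hoop_meet H x y) w"
        using massoc1[of w y x] c w by simp
    qed (use c w massoc1 in auto)
    show "(hoop_meet H (x \<otimes> y) w = x \<otimes> y) = (hoop_meet H x (y \<leadsto> w) = x)"
      using c w by (simp add: le_iff_meet currying)
  next
    fix x assume c: "x \<in> carrier H"
    show "hoop_meet H z x = z" using c z by (simp add: le_iff_meet)
    show "hoop_meet H x \<one> = x" using c by (simp add: le_iff_meet)
  qed (use z in auto)
qed

text \<open>Both sides are the infimum, respectively the supremum, for the same order.\<close>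

lemma product_algebra_meet_join:
  assumes "product_algebra B" and c: "x \<in> carrier B" "y \<in> carrier B"
  shows "x \<curlywedge>\<^bsub>B\<^esub> y = hoop_meet (U B) x y" and "x \<curlyvee>\<^bsub>B\<^esub> y = hoop_join (U B) x y"
proof -
  interpret B: product_algebra B by fact
  interpret H: product_hoop "U B" by (rule product_hoop_U) fact
  have wedge: "x \<curlywedge>\<^bsub>B\<^esub> y = hoop_meet (U B) x y"
    if "x \<in> carrier B" "y \<in> carrier B" for x y
    using that by (simp add: B.divisibility hoop_meet_def)
  show "x \<curlywedge>\<^bsub>B\<^esub> y = hoop_meet (U B) x y" by (rule wedge[OF c])
  have le: "H.le x y \<longleftrightarrow> x \<curlywedge>\<^bsub>B\<^esub> y = x" if "x \<in> carrier B" "y \<in> carrier B" for x y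
    using that wedge H.le_iff_meet[of x y] by simp
  let ?j = "x \<curlyvee>\<^bsub>B\<^esub> y" and ?h = "hoop_join (U B) x y"
  have h: "?h \<in> carrier B" using H.join_in_carrier[of x y] c by simp
  show "?j = ?h"
  proof (rule H.le_antisym)
    have "H.le x ?j" "H.le y ?j" using c le B.meet_absorb[of x y] B.meet_absorb[of y x]
        B.join_comm[of x y] by simp_all
    then show "H.le ?h ?j" using c by (intro H.join_least) auto
    have "x \<curlywedge>\<^bsub>B\<^esub> ?h = x" "y \<curlywedge>\<^bsub>B\<^esub> ?h = y" using H.join_upper[of x y] c h le by simp_all
    then have "?h \<curlyvee>\<^bsub>B\<^esub> x = ?h" "?h \<curlyvee>\<^bsub>B\<^esub> y = ?h"
      using B.join_absorb[of ?h] B.meet_comm c h by metis+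
    then have "?h \<curlyvee>\<^bsub>B\<^esub> ?j = ?h" using B.join_assoc[of ?h x y] c h by simp
    then have "?j \<curlywedge>\<^bsub>B\<^esub> ?h = ?j" using B.meet_absorb[of ?j ?h] B.join_comm c h by simp
    then show "H.le ?j ?h" using le c h by simp
  qed (use c h in auto)
qed

lemma palg_homI:
  fixes A :: "'a palg" and B :: "'b palg"
  assumes A: "product_algebra A" and B: "product_algebra B"
    and f: "f \<in> hoop_hom (U A) (U B)" "f \<zero>\<^bsub>A\<^esub> = \<zero>\<^bsub>B\<^esub>"
  shows "f \<in> palg_hom A B"
proof -
  interpret product_algebra A by fact
  have f': "f \<in> hoop_hom A B" "f \<in> carrier A \<rightarrow> carrier B" using f(1) by (auto simp: hoop_hom_def)
  then have "f (hoop_meet (U A) x y) = hoop_meet (U B) (f x) (f y)"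
    "f (hoop_join (U A) x y) = hoop_join (U B) (f x) (f y)"
    if "x \<in> carrier A" "y \<in> carrier A" for x y
    using that by (auto simp: hoop_join_def hoop_meet_def hoop_hom_def)
  then show ?thesis
    using f' f(2) by (auto simp: palg_hom_def product_algebra_meet_join[OF A] Pi_iff
        product_algebra_meet_join[OF B])
qed


section \<open>Quotients of product hoops by prime filters\<close>

context hoop
begin

definition hoop_filter :: "'a set \<Rightarrow> bool" where
  "hoop_filter F \<longleftrightarrow> F \<subseteq> carrier H \<and> \<one> \<in> F \<and>
     (\<forall>x\<in>F. \<forall>y\<in>carrier H. x \<leadsto> y \<in> F \<longrightarrow> y \<in> F)"

lemma filter_mp:
  "\<lbrakk>hoop_filter F; x \<in> F; x \<leadsto> y \<in> F; y \<in> carrier H\<rbrakk> \<Longrightarrow> y \<in> F"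
  unfolding hoop_filter_def by blast

lemma filter_up:
  assumes "hoop_filter F" "x \<in> F" "x \<preceq> y" "y \<in> carrier H"
  shows "y \<in> F"
proof (rule filter_mp[OF assms(1,2) _ assms(4)])
  show "x \<leadsto> y \<in> F" using assms(1,3) unfolding hoop_filter_def by metis
qed

lemma filter_sub: "hoop_filter F \<Longrightarrow> x \<in> F \<Longrightarrow> x \<in> carrier H"
  unfolding hoop_filter_def by blast

lemma exists_maximal_filter_avoiding:
  assumes c: "c \<in> carrier H" "c \<noteq> \<one>"
  shows "\<exists>P. hoop_filter P \<and> c \<notin> P \<and> (\<forall>F. hoop_filter F \<longrightarrow> P \<subseteq> F \<longrightarrow> c \<notin> F \<longrightarrow> F = P)"
proof -
  let ?S = "{F. hoop_filter F \<and> c \<notin> F}"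
  have "\<exists>M\<in>?S. \<forall>F\<in>?S. M \<subseteq> F \<longrightarrow> F = M"
  proof (rule subset_Zorn_nonempty)
    have "{\<one>} \<in> ?S" using c by (auto simp: hoop_filter_def)
    then show "?S \<noteq> {}" by blast
  next
    fix \<C> assume ne: "\<C> \<noteq> {}" and ch: "subset.chain ?S \<C>"
    then have S: "\<And>F. F \<in> \<C> \<Longrightarrow> hoop_filter F \<and> c \<notin> F"
      by (auto simp: subset_chain_def)
    have "hoop_filter (\<Union>\<C>)"
      unfolding hoop_filter_def
    proof (intro conjI ballI impI)
      show "\<Union>\<C> \<subseteq> carrier H" using S filter_sub by blast
      show "\<one> \<in> \<Union>\<C>" using S ne by (auto simp: hoop_filter_def)
      fix x y assume xy: "x \<in> \<Union>\<C>" "y \<in> carrier H" "x \<leadsto> y \<in> \<Union>\<C>"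
      then obtain F G where "F \<in> \<C>" "x \<in> F" "G \<in> \<C>" "x \<leadsto> y \<in> G" by blast
      moreover from this have "F \<subseteq> G \<or> G \<subseteq> F" using ch by (auto simp: subset_chain_def)
      ultimately show "y \<in> \<Union>\<C>" using S xy filter_mp by (metis UnionI subsetD)
    qed
    then show "\<Union>\<C> \<in> ?S" using S by auto
  qed
  then show ?thesis by blast
qed

end

context basic_hoop
begin

text \<open>The filter property rests on \<open>b \<or>\<^sub>h (x \<leadsto> y) \<preceq> (b \<or>\<^sub>h x) \<leadsto> (b \<or>\<^sub>h y)\<close>. These residuals stand in
  for the filter generated by \<open>F\<close> and one more element, whose description would involve powers.\<close>

lemma filter_join_residual:
  assumes F: "hoop_filter F" and b: "b \<in> carrier H"
  shows "hoop_filter {u \<in> carrier H. b \<or>\<^sub>h u \<in> F}"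
  unfolding hoop_filter_def
proof (intro conjI ballI impI)
  show "\<one> \<in> {u \<in> carrier H. b \<or>\<^sub>h u \<in> F}"
    using F b join_upper[of b \<one>] by (auto simp: hoop_filter_def)
  fix x y assume x: "x \<in> {u \<in> carrier H. b \<or>\<^sub>h u \<in> F}" and y: "y \<in> carrier H"
    and xy: "x \<leadsto> y \<in> {u \<in> carrier H. b \<or>\<^sub>h u \<in> F}"
  have "b \<or>\<^sub>h (x \<leadsto> y) \<preceq> (b \<or>\<^sub>h x) \<leadsto> (b \<or>\<^sub>h y)"
  proof (rule join_least)
    show "b \<preceq> (b \<or>\<^sub>h x) \<leadsto> (b \<or>\<^sub>h y)"
      using x y b le_imp[of "b \<or>\<^sub>h y" "b \<or>\<^sub>h x"] join_upper[of b y]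
        le_trans[of b "b \<or>\<^sub>h y" "(b \<or>\<^sub>h x) \<leadsto> (b \<or>\<^sub>h y)"] by simp
    have "b \<or>\<^sub>h x \<preceq> (x \<leadsto> y) \<leadsto> (b \<or>\<^sub>h y)"
    proof (rule join_least)
      show "b \<preceq> (x \<leadsto> y) \<leadsto> (b \<or>\<^sub>h y)"
        using x y b le_imp[of "b \<or>\<^sub>h y" "x \<leadsto> y"] join_upper[of b y]
          le_trans[of b "b \<or>\<^sub>h y" "(x \<leadsto> y) \<leadsto> (b \<or>\<^sub>h y)"] by simp
      have "x \<leadsto> y \<preceq> x \<leadsto> (b \<or>\<^sub>h y)"
        using x y b join_upper[of b y] by (intro imp_mono) auto
      then show "x \<preceq> (x \<leadsto> y) \<leadsto> (b \<or>\<^sub>h y)" using x y b by (simp add: imp_swap[of x])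
    qed (use x y b in auto)
    then show "x \<leadsto> y \<preceq> (b \<or>\<^sub>h x) \<leadsto> (b \<or>\<^sub>h y)"
      using x y b by (simp add: imp_swap[of "x \<leadsto> y"])
  qed (use x y b in auto)
  then have "(b \<or>\<^sub>h x) \<leadsto> (b \<or>\<^sub>h y) \<in> F"
    using x y xy b filter_up[OF F, of "b \<or>\<^sub>h (x \<leadsto> y)"] by simp
  then show "y \<in> {u \<in> carrier H. b \<or>\<^sub>h u \<in> F}"
    using x y b filter_mp[OF F, of "b \<or>\<^sub>h x"] by simp
qed auto

text \<open>Write \<open>Q b\<close> for the filter of all \<open>u\<close> with \<open>b \<or>\<^sub>h u \<in> P\<close>; it contains \<open>P\<close>, so it equals \<open>P\<close>
  unless it contains \<open>c\<close>. Take \<open>b = y \<leadsto> x\<close>. By prelinearity \<open>x \<leadsto> y\<close> belongs to \<open>Q b\<close>, which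
  settles the case \<open>Q b = P\<close>. Otherwise \<open>b \<or>\<^sub>h c \<in> P\<close>, that is, \<open>b \<in> Q c\<close>, and \<open>Q c = P\<close> because
  \<open>c \<or>\<^sub>h c = c\<close> is not in \<open>P\<close>.\<close>

lemma maximal_filter_prime:
  assumes P: "hoop_filter P" "c \<notin> P" and c: "c \<in> carrier H"
    and max: "\<And>F. hoop_filter F \<Longrightarrow> P \<subseteq> F \<Longrightarrow> c \<notin> F \<Longrightarrow> F = P"
    and xy: "x \<in> carrier H" "y \<in> carrier H"
  shows "x \<leadsto> y \<in> P \<or> y \<leadsto> x \<in> P"
proof -
  let ?a = "x \<leadsto> y" and ?b = "y \<leadsto> x"
  define Q where "Q b = {u \<in> carrier H. b \<or>\<^sub>h u \<in> P}" for b
  have ext: "Q b = P" if "b \<in> carrier H" "b \<or>\<^sub>h c \<notin> P" for b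
  proof (rule max)
    show "hoop_filter (Q b)" unfolding Q_def using filter_join_residual P that by blast
    show "P \<subseteq> Q b"
    proof
      fix u assume u: "u \<in> P"
      then have "u \<in> carrier H" using P(1) filter_sub by blast
      then show "u \<in> Q b"
        using filter_up[OF P(1) u join_upper(2)[of b u]] that(1) by (simp add: Q_def)
    qed
    show "c \<notin> Q b" using that by (simp add: Q_def)
  qed
  show ?thesis
  proof (cases "?b \<or>\<^sub>h c \<in> P")
    case True
    have "c \<or>\<^sub>h c = c" using le_antisym[OF join_least[of c c c] join_upper(1)] c by simp
    then have "Q c = P" using ext c P by simp
    moreover have "?b \<in> Q c" using True c xy join_comm by (simp add: Q_def)
    ultimately show ?thesis by simp
  next
    case False
    then have "Q ?b = P" using ext xy by simp
    moreover have "?a \<in> Q ?b" using prelinearity[of y x] xy P by (simp add: Q_def hoop_filter_def)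
    ultimately show ?thesis by simp
  qed
qed

end

definition filter_rel :: "'a hoop \<Rightarrow> 'a set \<Rightarrow> 'a \<Rightarrow> 'a \<Rightarrow> bool" where
  "filter_rel H P x y \<longleftrightarrow> x \<in> carrier H \<and> y \<in> carrier H \<and> x \<leadsto>\<^bsub>H\<^esub> y \<in> P \<and> y \<leadsto>\<^bsub>H\<^esub> x \<in> P"

definition hoop_quot :: "'a hoop \<Rightarrow> 'a set \<Rightarrow> 'a set hoop" where
  "hoop_quot H P = \<lparr>carrier = eq_class (filter_rel H P) ` carrier H,
     mult = quot_op (filter_rel H P) (mult H),
     one = eq_class (filter_rel H P) \<one>\<^bsub>H\<^esub>,
     imp = quot_op (filter_rel H P) (imp H)\<rparr>"

lemma filter_quotient:
  fixes H :: "'a hoop" (structure)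
  assumes "product_hoop H" and F: "hoop.hoop_filter H P"
  defines "q \<equiv> eq_class (filter_rel H P)"
  shows product_hoop_quot: "product_hoop (hoop_quot H P)"
    and quot_hom: "q \<in> hoop_hom H (hoop_quot H P)"
    and carrier_quot: "carrier (hoop_quot H P) = q ` carrier H"
    and quot_eq_one_iff: "x \<in> carrier H \<Longrightarrow> q x = \<one>\<^bsub>hoop_quot H P\<^esub> \<longleftrightarrow> x \<in> P"
proof -
  interpret product_hoop H by fact
  let ?R = "filter_rel H P"
  have tr: "x \<leadsto> z \<in> P" if "x \<leadsto> y \<in> P" "y \<leadsto> z \<in> P"
    "x \<in> carrier H" "y \<in> carrier H" "z \<in> carrier H" for x y z
    using that filter_up[OF F that(1) imp_trans[of x y z]]
      filter_mp[OF F that(2), of "x \<leadsto> z"] by simp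
  have one: "\<one> \<in> P" using F by (simp add: hoop_filter_def)
  have per: "symp ?R" "transp ?R"
    using tr by (auto simp: symp_def transp_def filter_rel_def)
  have refl: "?R x x" if "x \<in> carrier H" for x using that one by (simp add: filter_rel_def)
  have mul1: "x \<otimes> z \<leadsto> y \<otimes> z \<in> P"
    if "x \<leadsto> y \<in> P" "x \<in> carrier H" "y \<in> carrier H" "z \<in> carrier H" for x y z
    using that filter_up[OF F that(1) mult_imp_mult[of x y z]] by simp
  have mul: "?R (t \<otimes> u) (t' \<otimes> u')" if "?R t t'" "?R u u'" for t t' u u'
  proof -
    have "?R (t \<otimes> u) (t' \<otimes> u)" using that mul1 by (auto simp: filter_rel_def)
    moreover have "?R (t' \<otimes> u) (t' \<otimes> u')"
      using that mul1[of u u' t'] mul1[of u' u t'] by (auto simp: filter_rel_def m_comm)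
    ultimately show ?thesis by (rule transpD[OF per(2)])
  qed
  have imp1: "(y \<leadsto> z) \<leadsto> (x \<leadsto> z) \<in> P" "(z \<leadsto> x) \<leadsto> (z \<leadsto> y) \<in> P"
    if "x \<leadsto> y \<in> P" "x \<in> carrier H" "y \<in> carrier H" "z \<in> carrier H" for x y z
  proof -
    show "(y \<leadsto> z) \<leadsto> (x \<leadsto> z) \<in> P"
      using that filter_up[OF F that(1) imp_trans[of x y z]] by simp
    have "x \<leadsto> y \<preceq> (z \<leadsto> x) \<leadsto> (z \<leadsto> y)"
      using imp_trans[of z x y] imp_swap[of "z \<leadsto> x" "x \<leadsto> y" "z \<leadsto> y"] that by simp
    then show "(z \<leadsto> x) \<leadsto> (z \<leadsto> y) \<in> P"
      using that filter_up[OF F that(1)] by simp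
  qed
  have imp: "?R (t \<leadsto> u) (t' \<leadsto> u')" if "?R t t'" "?R u u'" for t t' u u'
  proof -
    have "?R (t \<leadsto> u) (t' \<leadsto> u)" using that imp1 by (auto simp: filter_rel_def)
    moreover have "?R (t' \<leadsto> u) (t' \<leadsto> u')"
      using that imp1 by (auto simp: filter_rel_def)
    ultimately show ?thesis by (rule transpD[OF per(2)])
  qed
  have eq: "q x = q y \<longleftrightarrow> ?R x y" if "x \<in> carrier H" for x y
    unfolding q_def by (rule eq_class_eq_iff[OF per refl[OF that]])
  have ops: "q x \<otimes>\<^bsub>hoop_quot H P\<^esub> q y = q (x \<otimes> y)" "q x \<leadsto>\<^bsub>hoop_quot H P\<^esub> q y = q (x \<leadsto> y)"
    if "x \<in> carrier H" "y \<in> carrier H" for x y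
    using quot_op_eq_class[OF per refl[OF that(1)] refl[OF that(2)], of "(\<otimes>)"] mul
      quot_op_eq_class[OF per refl[OF that(1)] refl[OF that(2)], of "(\<leadsto>)"] imp
    unfolding q_def hoop_quot_def by simp_all
  have car: "carrier (hoop_quot H P) = q ` carrier H"
    and one_q: "\<one>\<^bsub>hoop_quot H P\<^esub> = q \<one>"
    by (simp_all add: hoop_quot_def q_def)
  show "carrier (hoop_quot H P) = q ` carrier H" by (rule car)
  show "q \<in> hoop_hom H (hoop_quot H P)" by (auto simp: hoop_hom_def car one_q ops)
  show "x \<in> carrier H \<Longrightarrow> q x = \<one>\<^bsub>hoop_quot H P\<^esub> \<longleftrightarrow> x \<in> P"
    by (auto simp: one_q eq filter_rel_def one)
  show "product_hoop (hoop_quot H P)"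
    by (rule product_hoopI)
      (auto simp: car one_q ops hoop_join_def hoop_meet_def
        intro!: arg_cong[of _ _ q] m_assoc m_comm divisibility currying basic
          product_axiom[unfolded hoop_join_def hoop_meet_def] del: equalityI)
qed


section \<open>Embedding linearly ordered product hoops into product algebras\<close>

definition with_bottom :: "'a hoop \<Rightarrow> 'a option hoop" where
  "with_bottom C = \<lparr>carrier = insert None (Some ` carrier C),
     mult = (\<lambda>x y. case x of None \<Rightarrow> None | Some a \<Rightarrow>
       (case y of None \<Rightarrow> None | Some b \<Rightarrow> Some (a \<otimes>\<^bsub>C\<^esub> b))),
     one = Some \<one>\<^bsub>C\<^esub>,
     imp = (\<lambda>x y. case x of None \<Rightarrow> Some \<one>\<^bsub>C\<^esub> | Some a \<Rightarrow>
       (case y of None \<Rightarrow> None | Some b \<Rightarrow> Some (a \<leadsto>\<^bsub>C\<^esub> b)))\<rparr>"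

text \<open>For \<open>x, y\<close> in \<open>C\<close> the product axiom of the extension with \<open>z\<close> the new bottom demands that \<open>y\<close> can be
  cancelled: \<open>(y \<leadsto> (x \<otimes> y)) \<leadsto> x = \<one>\<close>. Choosing \<open>z\<close> in \<open>C\<close> with \<open>y \<leadsto> z \<noteq> \<one>\<close>, the product axiom of
  \<open>C\<close> yields this, since in a chain a join equals \<open>\<one>\<close> only if one of its arguments does.\<close>

lemma product_hoop_with_bottom:
  fixes C :: "'a hoop" (structure)
  assumes "product_hoop C"
    and linear: "\<And>x y. x \<in> carrier C \<Longrightarrow> y \<in> carrier C \<Longrightarrow> x \<leadsto> y = \<one> \<or> y \<leadsto> x = \<one>"
    and no_least: "\<And>y. y \<in> carrier C \<Longrightarrow> \<exists>z\<in>carrier C. y \<leadsto> z \<noteq> \<one>"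
  shows "product_hoop (with_bottom C)"
proof -
  interpret product_hoop C by fact
  have cancel: "(y \<leadsto> (x \<otimes> y)) \<leadsto> x = \<one>" if xy: "x \<in> carrier C" "y \<in> carrier C" for x y
  proof -
    obtain z where z: "z \<in> carrier C" "y \<leadsto> z \<noteq> \<one>" using no_least xy by blast
    let ?u = "y \<leadsto> z" and ?v = "(y \<leadsto> (x \<otimes> y)) \<leadsto> x"
    have j: "hoop_join C ?u ?v = \<one>" using product_axiom xy z by simp
    have "?u = \<one> \<or> ?v = \<one>"
      using linear[of ?u ?v] join_eq_one_imp[of ?u ?v] join_eq_one_imp[of ?v ?u] j
        join_comm[of ?u ?v] xy z by auto
    then show ?thesis using z by simp
  qed
  show ?thesis
    by (rule product_hoopI)
      (auto simp: with_bottom_def hoop_join_def hoop_meet_def currying basic m_assoc cancel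
        product_axiom[unfolded hoop_join_def hoop_meet_def] le_imp,
       auto simp: divisibility m_comm)
qed


section \<open>The unit of the adjunction has trivial kernel\<close>

text \<open>By \<open>product_algebra_palg_of\<close> the hoop \<open>D\<close> is a product algebra, so \<open>f\<close> factors through \<open>eta X\<close>.\<close>

lemma eta_neq_one_if_separated:
  fixes D :: "'d hoop"
  assumes X: "product_hoop X" and D: "product_hoop D"
    and z: "z \<in> carrier D" "\<And>x. x \<in> carrier D \<Longrightarrow> z \<leadsto>\<^bsub>D\<^esub> x = \<one>\<^bsub>D\<^esub>"
    and f: "f \<in> hoop_hom X D" and c: "c \<in> carrier X" "f c \<noteq> \<one>\<^bsub>D\<^esub>"
  shows "eta X c \<noteq> \<one>\<^bsub>K X\<^esub>"
proof
  assume *: "eta X c = \<one>\<^bsub>K X\<^esub>"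
  have A: "product_algebra (palg_of D z)" by (rule product_algebra_palg_of[OF D z])
  have "f \<in> hoop_hom X (U (palg_of D z))" using f by simp
  note ext = K_ext[OF X A this]
  show False
    using ext(1) ext(2)[OF c(1)] c(2) * by (simp add: palg_hom_def hoop_hom_def)
qed

lemma eta_trivial_kernel:
  assumes X: "product_hoop X" and c: "c \<in> carrier X" "eta X c = \<one>\<^bsub>K X\<^esub>"
  shows "c = \<one>\<^bsub>X\<^esub>"
proof (rule ccontr)
  assume "c \<noteq> \<one>\<^bsub>X\<^esub>"
  interpret X: product_hoop X by fact
  obtain P where P: "X.hoop_filter P" "c \<notin> P"
    and max: "\<And>F. X.hoop_filter F \<Longrightarrow> P \<subseteq> F \<Longrightarrow> c \<notin> F \<Longrightarrow> F = P"
    using X.exists_maximal_filter_avoiding[OF c(1) \<open>c \<noteq> \<one>\<^bsub>X\<^esub>\<close>] by blast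
  define C q where "C = hoop_quot X P" and "q = eq_class (filter_rel X P)"
  note quot = filter_quotient[OF X P(1), folded C_def q_def]
  interpret C: product_hoop C by (rule quot)
  have linear: "a \<leadsto>\<^bsub>C\<^esub> b = \<one>\<^bsub>C\<^esub> \<or> b \<leadsto>\<^bsub>C\<^esub> a = \<one>\<^bsub>C\<^esub>"
    if ab: "a \<in> carrier C" "b \<in> carrier C" for a b
  proof -
    obtain x y where xy: "a = q x" "b = q y" "x \<in> carrier X" "y \<in> carrier X"
      using ab quot(3) by auto
    then have "a \<leadsto>\<^bsub>C\<^esub> b = q (x \<leadsto>\<^bsub>X\<^esub> y)" "b \<leadsto>\<^bsub>C\<^esub> a = q (y \<leadsto>\<^bsub>X\<^esub> x)"
      using quot(2) by (simp_all add: hoop_hom_def)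
    then show ?thesis
      using X.maximal_filter_prime[OF P c(1) max xy(3,4)] xy quot(4) by auto
  qed
  have qc: "q c \<noteq> \<one>\<^bsub>C\<^esub>" using quot(4) c P by simp
  show False
  proof (cases "\<exists>z\<in>carrier C. \<forall>x\<in>carrier C. z \<leadsto>\<^bsub>C\<^esub> x = \<one>\<^bsub>C\<^esub>")
    case True
    then show False
      using eta_neq_one_if_separated[OF X quot(1) _ _ quot(2) c(1) qc] c(2) by blast
  next
    case False
    then have "product_hoop (with_bottom C)"
      by (intro product_hoop_with_bottom quot(1) linear) auto
    moreover have "(\<lambda>x. Some (q x)) \<in> hoop_hom X (with_bottom C)"
      using quot(2) by (auto simp: hoop_hom_def with_bottom_def)
    ultimately show False
      using eta_neq_one_if_separated[of X "with_bottom C" None "\<lambda>x. Some (q x)" c] X c qc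
      by (auto simp: with_bottom_def)
  qed
qed


section \<open>Coherent actions\<close>

lemma copair_imp:
  assumes "product_hoop C" "product_hoop X" "product_hoop D" "f \<in> hoop_hom C D" "g \<in> hoop_hom X D"
    and c: "c \<in> carrier C" and x: "x \<in> carrier X"
  shows "copair D f g (in_l C X c \<leadsto>\<^bsub>coprod C X\<^esub> in_r C X x) = f c \<leadsto>\<^bsub>D\<^esub> g x"
proof -
  have "in_l C X c \<in> carrier (coprod C X)" "in_r C X x \<in> carrier (coprod C X)"
    using in_l_hom[OF assms(1), of X] in_r_hom[OF assms(2), of C] c x by (auto simp: hoop_hom_def)
  then show ?thesis
    using copair_hom[OF assms(1-5)] copair_in_l[OF assms(1-5) c] copair_in_r[OF assms(1-5) x]
    by (simp add: hoop_hom_def)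
qed

lemma zero_imp_eq_one:
  fixes B :: "'b palg"
  assumes B: "product_algebra B" and b: "b \<in> carrier B"
  shows "\<zero>\<^bsub>B\<^esub> \<leadsto>\<^bsub>B\<^esub> b = \<one>\<^bsub>B\<^esub>"
proof -
  interpret B: product_algebra B by fact
  interpret UB: product_hoop "U B" by (rule product_hoop_U[OF B])
  show ?thesis
    using UB.le_iff_meet[of "\<zero>\<^bsub>B\<^esub>" b] b B.zero_least product_algebra_meet_join[OF B] by simp
qed

lemma const_one_hom:
  fixes B :: "'b palg"
  assumes "product_algebra B"
  shows "(\<lambda>_. \<one>\<^bsub>B\<^esub>) \<in> hoop_hom trivial_hoop (U B)"
proof -
  interpret UB: product_hoop "U B" by (rule product_hoop_U) fact
  show ?thesis
    using UB.imp_self[of "\<one>\<^bsub>B\<^esub>"] UB.one_closed UB.l_one by (simp add: hoop_hom_def)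
qed

text \<open>The terms \<open>0 \<leadsto> x\<close> at which the actions of \<open>K0\<close> and of \<open>B\<close> are compared.\<close>

lemma zero_imp_in_flat:
  assumes B: "product_algebra B" and X: "product_hoop X" and x: "x \<in> carrier X"
  shows "in_l (U B) X \<zero>\<^bsub>B\<^esub> \<leadsto>\<^bsub>coprod (U B) X\<^esub> in_r (U B) X x \<in> carrier (U B \<flat> X)"
proof -
  interpret B: product_algebra B by fact
  have UB: "product_hoop (U B)" by (rule product_hoop_U[OF B])
  interpret UB: product_hoop "U B" by fact
  interpret S: product_hoop "coprod (U B) X" by (rule product_hoop_coprod)
  have "copair (U B) (\<lambda>c. c) (\<lambda>_. \<one>\<^bsub>U B\<^esub>)
      (in_l (U B) X \<zero>\<^bsub>B\<^esub> \<leadsto>\<^bsub>coprod (U B) X\<^esub> in_r (U B) X x) = \<zero>\<^bsub>B\<^esub> \<leadsto>\<^bsub>U B\<^esub> \<one>\<^bsub>U B\<^esub>"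
    using UB.imp_self[of "\<one>\<^bsub>U B\<^esub>"] UB.l_one[of "\<one>\<^bsub>U B\<^esub>"] x
    by (intro copair_imp[OF UB X UB]) (auto simp: hoop_hom_def)
  moreover have "in_l (U B) X \<zero>\<^bsub>B\<^esub> \<in> carrier (coprod (U B) X)"
    "in_r (U B) X x \<in> carrier (coprod (U B) X)"
    using in_l_hom[OF UB, of X] in_r_hom[OF X, of "U B"] x by (auto simp: hoop_hom_def)
  ultimately show ?thesis
    using zero_imp_eq_one[OF B B.one_closed] by (simp add: flat_def)
qed

text \<open>The point has to be compared with \<open>K X\<close> through the actions only: the term \<open>t = (0 \<leadsto> x)\<close> over
  \<open>K0\<close> is mapped by \<open>iota B\<close> to the same term \<open>t'\<close> over \<open>B\<close>, so coherence gives
  \<open>\<xi> t' = \<xi>0 t\<close>. The value of \<open>\<xi>0 t\<close> is read off in \<open>K X\<close>, that of \<open>\<xi> t'\<close> in \<open>A\<close>.\<close>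

lemma coherent_section_of_zero_below_kernel:
  assumes B: "product_algebra B" and X: "product_hoop X" and coh: "coherent_action B X \<xi>"
    and assoc: "associated_via (U B) X \<xi> A p s k" and x: "x \<in> carrier X"
  shows "s \<zero>\<^bsub>B\<^esub> \<leadsto>\<^bsub>A\<^esub> k x = \<one>\<^bsub>A\<^esub>"
proof -
  let ?C0 = "U K0"
  have A: "product_hoop A" and s: "s \<in> hoop_hom (U B) A" and k: "k \<in> hoop_hom X A"
    and k\<xi>: "\<And>t. t \<in> carrier (U B \<flat> X) \<Longrightarrow> k (\<xi> t) = copair A s k t"
    using assoc by (auto simp: associated_via_def hoop_point_def is_kernel_def)
  have UB: "product_hoop (U B)" by (rule product_hoop_U[OF B])
  have C0: "product_hoop ?C0" by (rule product_hoop_U[OF product_algebra_K])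
  interpret B: product_algebra B by fact
  interpret K0: product_algebra K0 by (rule product_algebra_K)
  interpret UKX: product_hoop "U (K X)" by (rule product_hoop_U[OF product_algebra_K])
  obtain \<xi>0 where \<xi>0: "is_xi0 X \<xi>0"
    and \<xi>: "\<And>t. t \<in> carrier (?C0 \<flat> X) \<Longrightarrow> \<xi> (coprod_map (U B) X (iota B) (\<lambda>x. x) t) = \<xi>0 t"
    using coh by (auto simp: coherent_action_def)
  have iota: "iota B \<in> palg_hom K0 B"
    unfolding iota_def by (rule K_ext_hom[OF product_hoop_trivial B const_one_hom[OF B]])
  have eta: "eta X \<in> hoop_hom X (U (K X))" by (rule eta_hom[OF X])
  have K_map: "K_map X (\<lambda>_. \<one>\<^bsub>X\<^esub>) \<in> palg_hom K0 (K X)"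
  proof -
    have "eta X \<one>\<^bsub>X\<^esub> = \<one>\<^bsub>K X\<^esub>" using eta by (simp add: hoop_hom_def)
    then show ?thesis
      unfolding K_map_def
      using K_ext_hom[OF product_hoop_trivial product_algebra_K[of X]
          const_one_hom[OF product_algebra_K[of X]]] by simp
  qed
  have inl: "in_l (U B) X \<in> hoop_hom (U B) (coprod (U B) X)" by (rule in_l_hom[OF UB])
  have inr: "in_r (U B) X \<in> hoop_hom X (coprod (U B) X)" by (rule in_r_hom[OF X])
  define t where "t = in_l ?C0 X \<zero>\<^bsub>K0\<^esub> \<leadsto>\<^bsub>coprod ?C0 X\<^esub> in_r ?C0 X x"
  define t' where "t' = in_l (U B) X \<zero>\<^bsub>B\<^esub> \<leadsto>\<^bsub>coprod (U B) X\<^esub> in_r (U B) X x"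
  have t: "t \<in> carrier (?C0 \<flat> X)"
    unfolding t_def by (rule zero_imp_in_flat[OF product_algebra_K X x])
  have t': "t' \<in> carrier (U B \<flat> X)"
    unfolding t'_def by (rule zero_imp_in_flat[OF B X x])
  have "coprod_map (U B) X (iota B) (\<lambda>x. x) t
      = in_l (U B) X (iota B \<zero>\<^bsub>K0\<^esub>) \<leadsto>\<^bsub>coprod (U B) X\<^esub> in_r (U B) X x"
    unfolding coprod_map_def t_def
    using inl inr iota by (intro copair_imp[OF C0 X product_hoop_coprod])
      (auto simp: x palg_hom_def hoop_hom_def Pi_iff)
  then have map_t: "coprod_map (U B) X (iota B) (\<lambda>x. x) t = t'"
    using iota by (simp add: t'_def palg_hom_def)
  have "eta X (\<xi>0 t) = K_map X (\<lambda>_. \<one>\<^bsub>X\<^esub>) \<zero>\<^bsub>K0\<^esub> \<leadsto>\<^bsub>U (K X)\<^esub> eta X x"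
  proof -
    have "eta X (\<xi>0 t) = copair (U (K X)) (K_map X (\<lambda>_. \<one>\<^bsub>X\<^esub>)) (eta X) t"
      using \<xi>0 t by (simp add: is_xi0_def)
    also have "\<dots> = K_map X (\<lambda>_. \<one>\<^bsub>X\<^esub>) \<zero>\<^bsub>K0\<^esub> \<leadsto>\<^bsub>U (K X)\<^esub> eta X x"
      unfolding t_def using palg_hom_imp_hoop_hom[OF K_map] eta x
      by (intro copair_imp[OF C0 X UKX.product_hoop_axioms]) auto
    finally show ?thesis .
  qed
  also have "\<dots> = \<one>\<^bsub>K X\<^esub>"
  proof -
    have "eta X x \<in> carrier (K X)" using eta x by (auto simp: hoop_hom_def)
    then show ?thesis using K_map zero_imp_eq_one[OF product_algebra_K] by (simp add: palg_hom_def)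
  qed
  finally have "eta X (\<xi>0 t) = \<one>\<^bsub>K X\<^esub>" .
  moreover have "\<xi>0 t \<in> carrier X"
    using \<xi>0 t by (auto simp: is_xi0_def internal_action_def hoop_hom_def)
  ultimately have "\<xi>0 t = \<one>\<^bsub>X\<^esub>" using eta_trivial_kernel[OF X] by blast
  then have "\<xi> t' = \<one>\<^bsub>X\<^esub>" using \<xi>[OF t] map_t by simp
  then have "copair A s k t' = \<one>\<^bsub>A\<^esub>"
    using k\<xi>[OF t'] k by (simp add: hoop_hom_def)
  moreover have "copair A s k t' = s \<zero>\<^bsub>B\<^esub> \<leadsto>\<^bsub>A\<^esub> k x"
    unfolding t'_def using s k x by (intro copair_imp[OF UB X A]) auto
  ultimately show ?thesis by simp
qed

text \<open>The kernel determines all implications out of the idempotent \<open>s 0\<close>: the element \<open>s 0 \<leadsto> a\<close>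
  lies in the kernel, above \<open>s 0\<close> by the previous lemma, and \<open>s 0 \<leadsto> (s 0 \<leadsto> a) = s 0 \<leadsto> a\<close>.\<close>

lemma coherent_section_of_zero_least:
  assumes B: "product_algebra B" and X: "product_hoop X" and coh: "coherent_action B X \<xi>"
    and assoc: "associated_via (U B) X \<xi> A p s k" and a: "a \<in> carrier A"
  shows "s \<zero>\<^bsub>B\<^esub> \<leadsto>\<^bsub>A\<^esub> a = \<one>\<^bsub>A\<^esub>"
proof -
  have pt: "hoop_point (U B) A p s" and ker: "is_kernel X A (U B) p k"
    using assoc by (auto simp: associated_via_def)
  interpret UB: product_hoop "U B" by (rule product_hoop_U[OF B])
  interpret B: product_algebra B by fact
  interpret A: product_hoop A using pt by (simp add: hoop_point_def)
  let ?z = "s \<zero>\<^bsub>B\<^esub>"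
  have z: "?z \<in> carrier A" using pt by (auto simp: hoop_point_def hoop_hom_def)
  note zB = zero_imp_eq_one[OF B]
  have "p (?z \<leadsto>\<^bsub>A\<^esub> a) = \<zero>\<^bsub>B\<^esub> \<leadsto>\<^bsub>B\<^esub> p a"
    using pt a z by (simp add: hoop_point_def hoop_hom_def)
  also have "\<dots> = \<one>\<^bsub>B\<^esub>" using zB pt a by (auto simp: hoop_point_def hoop_hom_def)
  finally have "?z \<leadsto>\<^bsub>A\<^esub> a \<in> k ` carrier X"
    using ker a z by (auto simp: is_kernel_def)
  then obtain x where x: "x \<in> carrier X" "?z \<leadsto>\<^bsub>A\<^esub> a = k x" by auto
  have "\<zero>\<^bsub>B\<^esub> \<otimes>\<^bsub>B\<^esub> \<zero>\<^bsub>B\<^esub> = \<zero>\<^bsub>B\<^esub>"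
    using UB.divisibility[of "\<zero>\<^bsub>B\<^esub>" "\<zero>\<^bsub>B\<^esub> \<otimes>\<^bsub>B\<^esub> \<zero>\<^bsub>B\<^esub>"] UB.mult_le[of "\<zero>\<^bsub>B\<^esub>" "\<zero>\<^bsub>B\<^esub>"] zB by simp
  moreover have "s (\<zero>\<^bsub>B\<^esub> \<otimes>\<^bsub>B\<^esub> \<zero>\<^bsub>B\<^esub>) = ?z \<otimes>\<^bsub>A\<^esub> ?z"
    using pt by (simp add: hoop_point_def hoop_hom_def)
  ultimately have "?z \<otimes>\<^bsub>A\<^esub> ?z = ?z" by simp
  then have "?z \<leadsto>\<^bsub>A\<^esub> a = ?z \<leadsto>\<^bsub>A\<^esub> (?z \<leadsto>\<^bsub>A\<^esub> a)"
    using A.currying[of ?z ?z a] z a by simp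
  also have "\<dots> = \<one>\<^bsub>A\<^esub>"
    using coherent_section_of_zero_below_kernel[OF B X coh assoc x(1)] x by simp
  finally show ?thesis .
qed

lemma coherent_ideal_via:
  assumes B: "product_algebra B" and X: "product_hoop X" and coh: "coherent_action B X \<xi>"
    and assoc: "associated_via (U B) X \<xi> A p s k"
  shows "ideal_via B A p s (palg_of A (s \<zero>\<^bsub>B\<^esub>)) p s (\<lambda>a. a)"
proof -
  have pt: "hoop_point (U B) A p s" using assoc by (auto simp: associated_via_def)
  then have hom: "p \<in> hoop_hom A (U B)" "s \<in> hoop_hom (U B) A" and A: "product_hoop A"
    by (auto simp: hoop_point_def)
  interpret B: product_algebra B by fact
  have z: "s \<zero>\<^bsub>B\<^esub> \<in> carrier A" using hom by (auto simp: hoop_hom_def)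
  have A': "product_algebra (palg_of A (s \<zero>\<^bsub>B\<^esub>))"
    by (rule product_algebra_palg_of[OF A z])
      (rule coherent_section_of_zero_least[OF B X coh assoc])
  have "p \<in> palg_hom (palg_of A (s \<zero>\<^bsub>B\<^esub>)) B" "s \<in> palg_hom B (palg_of A (s \<zero>\<^bsub>B\<^esub>))"
    using pt by (auto intro!: palg_homI A' B simp: hoop_point_def)
  then show ?thesis
    using A' pt
    by (auto simp: ideal_via_def palg_point_def hoop_point_def hoop_hom_def bij_betw_def)
qed

theorem theorem6p39:
  shows "BAT TYPE('b) TYPE('x) TYPE('y) TYPE('a) TYPE('d)"
  unfolding BAT_def
proof (intro conjI allI impI)
  fix B :: "'b palg" and X :: "'x hoop" and \<xi>
  assume "product_algebra B" "product_hoop X" "coherent_action B X \<xi>"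
  then show "ideal_action TYPE('a) B X \<xi>"
    unfolding ideal_action_def ideal_point_def
    by (meson associated_via_def coherent_ideal_via)
next
  fix B :: "'b palg" and X :: "'x hoop" and \<xi> and Y :: "'y hoop" and \<zeta> f
  assume B: "product_algebra B" and XY: "product_hoop X" "product_hoop Y"
    and coh: "coherent_action B X \<xi>" "coherent_action B Y \<zeta>"
  show "ideal_action_hom TYPE('a) TYPE('d) B X \<xi> Y \<zeta> f"
    unfolding ideal_action_hom_def
  proof (intro allI impI)
    fix A :: "'a hoop" and p s k and D :: "'d hoop" and q r l h
    assume assoc: "associated_via (U B) X \<xi> A p s k" "associated_via (U B) Y \<zeta> D q r l"
      and h: "hoop_point_hom A p s D q r (U B) h"
    let ?A = "palg_of A (s \<zero>\<^bsub>B\<^esub>)" and ?D = "palg_of D (r \<zero>\<^bsub>B\<^esub>)"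
    note ideal = coherent_ideal_via[OF B XY(1) coh(1) assoc(1)]
      coherent_ideal_via[OF B XY(2) coh(2) assoc(2)]
    interpret B: product_algebra B by fact
    have "h \<in> palg_hom ?A ?D"
      using ideal h by (intro palg_homI) (auto simp: ideal_via_def palg_point_def hoop_point_hom_def)
    then have "palg_point_hom ?A p s ?D q r B h"
      using h by (simp add: palg_point_hom_def hoop_point_hom_def)
    with ideal h show "ideal_point_hom B A p s D q r h"
      unfolding ideal_point_hom_def by blast
  qed
qed

end
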